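(* Let $G$ be a finite simple undirected graph. For every $n\ge0$, the map $\psi$ induces a homomorphism $\psi_*:\mathcal{H}^{\mathrm{Cube}}_n(G)\to\mathcal{H}^{\mathrm{Path}}_n(G)$. For $n\le1$, $\psi_*$ is an isomorphism, and for $n=2$ it is surjective.
   Context: $R$ is a commutative ring with unit. A graph homomorphism is a vertex map sending adjacent vertices to equal or adjacent vertices. $Q_n$ is the graph on $\{0,1\}^n$ with Hamming-distance-one edges ($Q_0$ a single vertex). Discrete cubical homology: a singular $n$-cube is a graph homomorphism $\sigma: Q_n\to G$; $\mathcal{L}^{\mathrm{Cube}}_n(G)$ is the free $R$-module on them. For $n\ge1$, $i\in[n]$: $f_i^{\pm}\sigma(a_1,\dots,a_{n-1})=\sigma(a_1,\dots,a_{i-1},\epsilon,a_i,\dots,a_{n-1})$, $\epsilon=1$ for $+$, $0$ for $-$; $\sigma$ is degenerate if $f_i^+\sigma=f_i^-\sigma$ for some $i$. $\mathcal{C}^{\mathrm{Cube}}_n(G)$ is $\mathcal{L}^{\mathrm{Cube}}_n(G)$ modulo degenerate cubes, $\partial_n\sigma=\sum_{i=1}^n(-1)^i(f_i^-\sigma-f_i^+\sigma)$, $\partial_0=0$; $\mathcal{H}^{\mathrm{Cube}}_n(G)$ is its homology. Path homology: for $V=V(G)$, $\mathcal{C}_n(V)$ is the free $R$-module on $(n+1)$-tuples of vertices modulo tuples with $v_i=v_{i+1}$ for some $i$, $\partial_n(v_0,\dots,v_n)=\sum_{i=0}^n(-1)^i(v_0,\dots,\widehat{v_i},\dots,v_n)$,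 $\partial_0=0$. $\widetilde{\mathcal{C}}_n(G)$ is generated by allowed paths (tuples with $\{v_i,v_{i+1}\}\in E(G)$ for all $i$), $\widetilde{\mathcal{C}}_{-1}=0$; $\mathcal{C}^{\mathrm{Path}}_n(G)=\{x\in\widetilde{\mathcal{C}}_n(G):\partial_nx\in\widetilde{\mathcal{C}}_{n-1}(G)\}$, and $\mathcal{H}^{\mathrm{Path}}_n(G)$ is its homology. The map $\psi$: for $\tau\in S_n$, $p_\tau$ is the path $p_\tau(0),\dots,p_\tau(n)$ in $Q_n$ from $(0,\dots,0)$ whose $i$-th step flips coordinate $\tau(i)$ from $0$ to $1$; $\psi(\sigma)=\sum_{\tau\in S_n}\mathrm{sign}(\tau)\,(\sigma(p_\tau(0)),\dots,\sigma(p_\tau(n)))$, extended linearly; it gives maps $\psi:\mathcal{C}^{\mathrm{Cube}}_n(G)\to\mathcal{C}^{\mathrm{Path}}_n(G)$. *)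

theory Defs
  imports
    "HOL-Algebra.Module"
    "HOL-Algebra.AbelCoset"
    "HOL-Combinatorics.Permutations"
    "HOL-Library.Poly_Mapping"
    "HOL-Library.FuncSet"
begin

section \<open>Modules over a commutative ring with unit\<close>

text \<open>
  The coefficient ring is a type of sort \<open>{comm_ring, comm_monoid_mult}\<close>: a commutative ring with
  unit in which, unlike in class \<^class>\<open>comm_ring_1\<close>, the equation \<open>0 = 1\<close> is not excluded.
  Modules are records of HOL-Algebra; their ring multiplication and unit are not used.
\<close>

definition pm_scale :: "'r::{comm_ring,comm_monoid_mult} \<Rightarrow> ('x \<Rightarrow>\<^sub>0 'r) \<Rightarrow> ('x \<Rightarrow>\<^sub>0 'r)" where
  "pm_scale r c = Poly_Mapping.map (\<lambda>a. r * a) c"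

definition free_mod ::
  "'x set \<Rightarrow> ('r::{comm_ring,comm_monoid_mult}, 'x \<Rightarrow>\<^sub>0 'r) module" where
  "free_mod S = \<lparr>carrier = {c. Poly_Mapping.keys c \<subseteq> S}, monoid.mult = undefined, one = undefined,
     zero = 0, add = (+), smult = pm_scale\<rparr>"

definition lin_ext ::
  "('x \<Rightarrow> ('y \<Rightarrow>\<^sub>0 'r::{comm_ring,comm_monoid_mult})) \<Rightarrow> ('x \<Rightarrow>\<^sub>0 'r) \<Rightarrow> ('y \<Rightarrow>\<^sub>0 'r)" where
  "lin_ext g c = (\<Sum>x\<in>Poly_Mapping.keys c. pm_scale (Poly_Mapping.lookup c x) (g x))"

definition quot_mod :: "('r, 'x) module \<Rightarrow> 'x set \<Rightarrow> ('r, 'x set) module" where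
  "quot_mod M N = \<lparr>carrier = a_rcosets\<^bsub>M\<^esub> N, monoid.mult = undefined, one = undefined,
     zero = N, add = (\<lambda>X Y. X <+>\<^bsub>M\<^esub> Y),
     smult = (\<lambda>r X. N <+>\<^bsub>M\<^esub> ((\<lambda>x. r \<odot>\<^bsub>M\<^esub> x) ` X))\<rparr>"

text \<open>
  The map into \<open>quot_mod M N\<close> induced on cosets by a map \<open>f\<close> into \<open>M\<close>. The value at \<open>X\<close> is
  the union of the cosets \<open>N + f x\<close> for \<open>x \<in> X\<close>; it is a single coset, i.e. an element of
  \<open>quot_mod M N\<close>, exactly when \<open>f\<close> is well defined on the class \<open>X\<close>.
\<close>

definition quot_map :: "('r, 'y) module \<Rightarrow> 'y set \<Rightarrow> ('x \<Rightarrow> 'y) \<Rightarrow> 'x set \<Rightarrow> 'y set" where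
  "quot_map M N f X = N <+>\<^bsub>M\<^esub> (f ` X)"

definition mod_hom :: "('r, 'x) module \<Rightarrow> ('r, 'y) module \<Rightarrow> ('x \<Rightarrow> 'y) set" where
  "mod_hom M N = {h \<in> carrier M \<rightarrow> carrier N.
     (\<forall>x\<in>carrier M. \<forall>y\<in>carrier M. h (x \<oplus>\<^bsub>M\<^esub> y) = h x \<oplus>\<^bsub>N\<^esub> h y) \<and>
     (\<forall>r. \<forall>x\<in>carrier M. h (r \<odot>\<^bsub>M\<^esub> x) = r \<odot>\<^bsub>N\<^esub> h x)}"

definition mod_iso :: "('r, 'x) module \<Rightarrow> ('r, 'y) module \<Rightarrow> ('x \<Rightarrow> 'y) set" where
  "mod_iso M N = {h \<in> mod_hom M N. bij_betw h (carrier M) (carrier N)}"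


section \<open>Homology of a chain complex\<close>

text \<open>
  A complex is given by modules \<open>C n\<close> and maps \<open>d n\<close> from \<open>C n\<close> to \<open>C (n - 1)\<close>. There is no
  \<open>C (-1)\<close>: the map \<open>d 0\<close> is the zero map from \<open>C 0\<close> to \<open>C (0 - 1) = C 0\<close>.
\<close>

definition cycles ::
  "(nat \<Rightarrow> ('r, 'x) module) \<Rightarrow> (nat \<Rightarrow> 'x \<Rightarrow> 'x) \<Rightarrow> nat \<Rightarrow> 'x set" where
  "cycles C d n = a_kernel (C n) (C (n - 1)) (d n)"

definition boundaries ::
  "(nat \<Rightarrow> ('r, 'x) module) \<Rightarrow> (nat \<Rightarrow> 'x \<Rightarrow> 'x) \<Rightarrow> nat \<Rightarrow> 'x set" where
  "boundaries C d n = d (Suc n) ` carrier (C (Suc n))"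

definition homology ::
  "(nat \<Rightarrow> ('r, 'x) module) \<Rightarrow> (nat \<Rightarrow> 'x \<Rightarrow> 'x) \<Rightarrow> nat \<Rightarrow> ('r, 'x set) module" where
  "homology C d n = quot_mod ((C n)\<lparr>carrier := cycles C d n\<rparr>) (boundaries C d n)"

definition homology_class ::
  "(nat \<Rightarrow> ('r, 'x) module) \<Rightarrow> (nat \<Rightarrow> 'x \<Rightarrow> 'x) \<Rightarrow> nat \<Rightarrow> 'x \<Rightarrow> 'x set" where
  "homology_class C d n z = boundaries C d n +>\<^bsub>C n\<^esub> z"


section \<open>Graphs and the hypercube\<close>

type_synonym 'a ugraph = "'a set \<times> 'a set set"

definition verts :: "'a ugraph \<Rightarrow> 'a set" where "verts G = fst G"

definition edges :: "'a ugraph \<Rightarrow> 'a set set" where "edges G = snd G"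

definition finite_simple_graph :: "'a ugraph \<Rightarrow> bool" where
  "finite_simple_graph G \<longleftrightarrow> finite (verts G) \<and> (\<forall>e\<in>edges G. e \<subseteq> verts G \<and> card e = 2)"

definition graph_hom :: "'a ugraph \<Rightarrow> 'b ugraph \<Rightarrow> ('a \<Rightarrow> 'b) \<Rightarrow> bool" where
  "graph_hom G H f \<longleftrightarrow> f ` verts G \<subseteq> verts H \<and>
     (\<forall>u\<in>verts G. \<forall>v\<in>verts G. {u, v} \<in> edges G \<longrightarrow> f u = f v \<or> {f u, f v} \<in> edges H)"

text \<open>Elements of \<open>{0,1}\<^sup>n\<close> are Boolean lists of length \<open>n\<close>, with \<^term>\<open>True\<close> for \<open>1\<close>.\<close>

definition hypercube :: "nat \<Rightarrow> bool list ugraph" where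
  "hypercube n = ({u. length u = n},
     {{u, v} | u v. length u = n \<and> length v = n \<and> card {i. i < n \<and> u ! i \<noteq> v ! i} = 1})"


section \<open>Discrete cubical homology\<close>

text \<open>
  Cubes are extensional functions, so that cubes agreeing on the vertices of the hypercube are
  equal.
\<close>

type_synonym 'a cube = "bool list \<Rightarrow> 'a"

definition sing_cubes :: "'a ugraph \<Rightarrow> nat \<Rightarrow> 'a cube set" where
  "sing_cubes G n = {\<sigma> \<in> extensional (verts (hypercube n)). graph_hom (hypercube n) G \<sigma>}"

definition face :: "nat \<Rightarrow> nat \<Rightarrow> bool \<Rightarrow> 'a cube \<Rightarrow> 'a cube" where
  "face n i e \<sigma> =
     restrict (\<lambda>a. \<sigma> (take (i - 1) a @ e # drop (i - 1) a)) (verts (hypercube (n - 1)))"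

definition degenerate_cubes :: "'a ugraph \<Rightarrow> nat \<Rightarrow> 'a cube set" where
  "degenerate_cubes G n =
     {\<sigma> \<in> sing_cubes G n. \<exists>i\<in>{1..n}. face n i True \<sigma> = face n i False \<sigma>}"

definition cube_boundary ::
  "nat \<Rightarrow> 'a cube \<Rightarrow> ('a cube \<Rightarrow>\<^sub>0 'r::{comm_ring,comm_monoid_mult})" where
  "cube_boundary n \<sigma> = (\<Sum>i = 1..n. pm_scale ((- 1) ^ i)
     (Poly_Mapping.single (face n i False \<sigma>) 1 - Poly_Mapping.single (face n i True \<sigma>) 1))"

type_synonym ('a, 'r) cube_chain = "('a cube \<Rightarrow>\<^sub>0 'r) set"

definition degenerate_cube_chains ::
  "'a ugraph \<Rightarrow> nat \<Rightarrow> ('a cube \<Rightarrow>\<^sub>0 'r::{comm_ring,comm_monoid_mult}) set" where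
  "degenerate_cube_chains G n = carrier (free_mod (degenerate_cubes G n))"

definition CCube ::
  "'a ugraph \<Rightarrow> nat \<Rightarrow> ('r::{comm_ring,comm_monoid_mult}, ('a, 'r) cube_chain) module" where
  "CCube G n = quot_mod (free_mod (sing_cubes G n)) (degenerate_cube_chains G n)"

definition dCube :: "'a ugraph \<Rightarrow> nat \<Rightarrow>
    ('a, 'r::{comm_ring,comm_monoid_mult}) cube_chain \<Rightarrow> ('a, 'r) cube_chain" where
  "dCube G n = quot_map (free_mod (sing_cubes G (n - 1))) (degenerate_cube_chains G (n - 1))
     (lin_ext (cube_boundary n))"

definition HCube ::
  "'a ugraph \<Rightarrow> nat \<Rightarrow> ('r::{comm_ring,comm_monoid_mult}, ('a, 'r) cube_chain set) module" where
  "HCube G = homology (CCube G) (dCube G)"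


section \<open>Path homology\<close>

definition tuples :: "'a set \<Rightarrow> nat \<Rightarrow> 'a list set" where
  "tuples V n = {t. length t = Suc n \<and> set t \<subseteq> V}"

definition degenerate_tuples :: "'a set \<Rightarrow> nat \<Rightarrow> 'a list set" where
  "degenerate_tuples V n = {t \<in> tuples V n. \<exists>i<n. t ! i = t ! Suc i}"

definition allowed_paths :: "'a ugraph \<Rightarrow> nat \<Rightarrow> 'a list set" where
  "allowed_paths G n = {t \<in> tuples (verts G) n. \<forall>i<n. {t ! i, t ! Suc i} \<in> edges G}"

definition tuple_boundary ::
  "nat \<Rightarrow> 'a list \<Rightarrow> ('a list \<Rightarrow>\<^sub>0 'r::{comm_ring,comm_monoid_mult})" where
  "tuple_boundary n t = (if n = 0 then 0 else
     (\<Sum>i = 0..n. pm_scale ((- 1) ^ i) (Poly_Mapping.single (take i t @ drop (Suc i) t) 1)))"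

type_synonym ('a, 'r) path_chain = "('a list \<Rightarrow>\<^sub>0 'r) set"

definition degenerate_tuple_chains ::
  "'a set \<Rightarrow> nat \<Rightarrow> ('a list \<Rightarrow>\<^sub>0 'r::{comm_ring,comm_monoid_mult}) set" where
  "degenerate_tuple_chains V n = carrier (free_mod (degenerate_tuples V n))"

definition CTuple ::
  "'a set \<Rightarrow> nat \<Rightarrow> ('r::{comm_ring,comm_monoid_mult}, ('a, 'r) path_chain) module" where
  "CTuple V n = quot_mod (free_mod (tuples V n)) (degenerate_tuple_chains V n)"

definition dTuple :: "'a set \<Rightarrow> nat \<Rightarrow>
    ('a, 'r::{comm_ring,comm_monoid_mult}) path_chain \<Rightarrow> ('a, 'r) path_chain" where
  "dTuple V n = quot_map (free_mod (tuples V (n - 1))) (degenerate_tuple_chains V (n - 1))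
     (lin_ext (tuple_boundary n))"

text \<open>The submodule of \<^term>\<open>CTuple (verts G) n\<close> generated by the classes of allowed paths.\<close>

definition allowed_chains ::
  "'a ugraph \<Rightarrow> nat \<Rightarrow> ('a, 'r::{comm_ring,comm_monoid_mult}) path_chain set" where
  "allowed_chains G n =
     (\<lambda>c. degenerate_tuple_chains (verts G) n +>\<^bsub>free_mod (tuples (verts G) n)\<^esub> c) `
       carrier (free_mod (allowed_paths G n))"

text \<open>
  For \<open>n = 0\<close> the boundary is zero, so the condition on \<^term>\<open>dTuple (verts G) n x\<close> holds
  trivially, as it does with the convention that the allowed chains in degree \<open>-1\<close> are zero.
\<close>

definition CPath ::
  "'a ugraph \<Rightarrow> nat \<Rightarrow> ('r::{comm_ring,comm_monoid_mult}, ('a, 'r) path_chain) module" where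
  "CPath G n = (CTuple (verts G) n)
     \<lparr>carrier := {x \<in> allowed_chains G n. dTuple (verts G) n x \<in> allowed_chains G (n - 1)}\<rparr>"

definition dPath :: "'a ugraph \<Rightarrow> nat \<Rightarrow>
    ('a, 'r::{comm_ring,comm_monoid_mult}) path_chain \<Rightarrow> ('a, 'r) path_chain" where
  "dPath G n = dTuple (verts G) n"

definition HPath ::
  "'a ugraph \<Rightarrow> nat \<Rightarrow> ('r::{comm_ring,comm_monoid_mult}, ('a, 'r) path_chain set) module" where
  "HPath G = homology (CPath G) (dPath G)"


section \<open>The comparison map\<close>

text \<open>
  The vertex of the hypercube reached from \<open>(0,\<dots>,0)\<close> after flipping the coordinates
  \<open>\<tau> 1, \<dots>, \<tau> k\<close>.
\<close>

definition perm_path :: "nat \<Rightarrow> (nat \<Rightarrow> nat) \<Rightarrow> nat \<Rightarrow> bool list" where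
  "perm_path n \<tau> k = map (\<lambda>j. j \<in> \<tau> ` {1..k}) [1..<Suc n]"

definition psi_cube ::
  "nat \<Rightarrow> 'a cube \<Rightarrow> ('a list \<Rightarrow>\<^sub>0 'r::{comm_ring,comm_monoid_mult})" where
  "psi_cube n \<sigma> = (\<Sum>\<tau> | \<tau> permutes {1..n}. pm_scale (if evenperm \<tau> then 1 else - 1)
     (Poly_Mapping.single (map (\<lambda>k. \<sigma> (perm_path n \<tau> k)) [0..<Suc n]) 1))"

definition psi :: "'a ugraph \<Rightarrow> nat \<Rightarrow>
    ('a, 'r::{comm_ring,comm_monoid_mult}) cube_chain \<Rightarrow> ('a, 'r) path_chain" where
  "psi G n = quot_map (free_mod (tuples (verts G) n)) (degenerate_tuple_chains (verts G) n)
     (lin_ext (psi_cube n))"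

definition psi_star :: "'a ugraph \<Rightarrow> nat \<Rightarrow>
    ('a, 'r::{comm_ring,comm_monoid_mult}) cube_chain set \<Rightarrow> ('a, 'r) path_chain set" where
  "psi_star G n = quot_map (CPath G n) (boundaries (CPath G) (dPath G) n) (psi G n)"

end

theory Submission
  imports Defs
begin

text \<open>
  In degrees 0 and 1 the map \<open>\<psi>\<close> is an isomorphism of chain modules, and in degree 2 it is onto:
  modulo degenerate tuples, a chain of allowed paths \<open>(u, v, w)\<close> whose boundary is allowed is a
  combination of differences \<open>(u, v, w) - (u, m, w)\<close>, where \<open>m\<close> depends only on \<open>u\<close> and \<open>w\<close>,
  and each difference is the image of a singular square. Since \<open>\<psi>\<close> is a chain map, diagram
  chases give the claims on homology. That \<open>\<psi>\<close> commutes with the boundaries holds already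
  before dividing by degenerate chains: deleting an inner vertex of the path of \<open>\<tau>\<close> gives terms
  that cancel under composition of \<open>\<tau>\<close> with an adjacent transposition, and deleting the last or
  first vertex gives the paths in the faces \<open>f\<^sub>i\<^sup>-\<close> and \<open>f\<^sub>i\<^sup>+\<close>. The identity \<open>\<partial>\<partial> = 0\<close> is
  never used, as homology is treated as the image of the cycles in the chains modulo boundaries.
\<close>

section \<open>Quotients\<close>

text \<open>Lifting a path cycle to a cubical cycle takes surjectivity of \<psi> in its degree and
  injectivity one degree lower; pulling back a boundary takes injectivity in its degree and
  surjectivity one degree higher. This is how the facts on chains in degrees 0, 1 and 2 turn into
  the ranges of the claims on homology. On chains, \<psi> need not be injective in degree 2: a
  square and the square with its two coordinates exchanged have opposite images.

  Since 2 may be zero or a zero divisor in the ring, a signed sum S cannot be shown to vanish from S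
  = -S; its terms are cancelled in pairs.

  Scalars form a type, not a ring record. Modules are therefore treated as abelian groups on which
  each scalar acts by an additive map, and this structure passes to cosets.\<close>

locale scaled_group = abelian_group M
  for M :: "('r, 'x) module" (structure) +
  assumes smult_closed: "x \<in> carrier M \<Longrightarrow> r \<odot> x \<in> carrier M"
    and smult_add: "\<lbrakk>x \<in> carrier M; y \<in> carrier M\<rbrakk> \<Longrightarrow> r \<odot> (x \<oplus> y) = r \<odot> x \<oplus> r \<odot> y"

locale scaled_subgroup = scaled_group M + additive_subgroup N M
  for N and M :: "('r, 'x) module" (structure) +
  assumes smult_in: "x \<in> N \<Longrightarrow> r \<odot> x \<in> N"
begin

sublocale abelian_subgroup N M
  by (intro abelian_subgroupI3 additive_subgroup_axioms abelian_group_axioms)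

lemma coset_eq_iff:
  assumes "x \<in> carrier M" "y \<in> carrier M"
  shows "N +> x = N +> y \<longleftrightarrow> x \<ominus> y \<in> N"
  using assms a_rcos_module[of y x] a_subgroup
  by (metis a_minus_def a_rcos_self a_repr_independence)

end

text \<open>Each element n' + h (n + x) of the union of cosets rearranges to (n' + h n) + h x, and
  n' + h n lies in \<open>N'\<close>. The condition on \<open>h\<close> is additivity, so that
  multiplication by a fixed scalar is also an instance; this is how scalars act on cosets in
  \<open>smult_coset\<close>.\<close>

lemma quot_map_coset:
  assumes "scaled_subgroup N M" "scaled_subgroup N' M'"
    and h: "h \<in> carrier M \<rightarrow> carrier M'"
    and add: "\<And>x y. \<lbrakk>x \<in> carrier M; y \<in> carrier M\<rbrakk> \<Longrightarrow> h (x \<oplus>\<^bsub>M\<^esub> y) = h x \<oplus>\<^bsub>M'\<^esub> h y"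
    and N: "h ` N \<subseteq> N'" and x: "x \<in> carrier M"
  shows "quot_map M' N' h (N +>\<^bsub>M\<^esub> x) = N' +>\<^bsub>M'\<^esub> h x"
proof -
  interpret N: scaled_subgroup N M by fact
  interpret N': scaled_subgroup N' M' by fact
  have eq: "n' \<oplus>\<^bsub>M'\<^esub> h (n \<oplus>\<^bsub>M\<^esub> x) = (n' \<oplus>\<^bsub>M'\<^esub> h n) \<oplus>\<^bsub>M'\<^esub> h x" "n' \<oplus>\<^bsub>M'\<^esub> h n \<in> N'"
    if "n \<in> N" "n' \<in> N'" for n n'
    using that N h x by (auto simp: add N'.a_assoc Pi_iff image_subset_iff)
  \<comment> \<open>The choice n = 0 already yields the whole coset of h x: translation by h 0, an
    element of \<open>N'\<close>, maps \<open>N'\<close> onto itself.\<close>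
  have "N' \<subseteq> (\<lambda>n'. n' \<oplus>\<^bsub>M'\<^esub> h \<zero>\<^bsub>M\<^esub>) ` N'"
  proof
    fix n' assume n': "n' \<in> N'"
    have "h \<zero>\<^bsub>M\<^esub> \<in> N'" using N by auto
    with n' have "n' = (n' \<ominus>\<^bsub>M'\<^esub> h \<zero>\<^bsub>M\<^esub>) \<oplus>\<^bsub>M'\<^esub> h \<zero>\<^bsub>M\<^esub>" "n' \<ominus>\<^bsub>M'\<^esub> h \<zero>\<^bsub>M\<^esub> \<in> N'"
      by (auto simp: N'.minus_eq N'.a_assoc N'.l_neg)
    then show "n' \<in> (\<lambda>n'. n' \<oplus>\<^bsub>M'\<^esub> h \<zero>\<^bsub>M\<^esub>) ` N'" by blast
  qed
  then have "\<exists>n\<in>N. \<exists>m\<in>N'. n' \<oplus>\<^bsub>M'\<^esub> h x = m \<oplus>\<^bsub>M'\<^esub> h (n \<oplus>\<^bsub>M\<^esub> x)" if "n' \<in> N'" for n'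
    using that by (intro bexI[of _ "\<zero>\<^bsub>M\<^esub>"]) (auto simp: eq)
  then show ?thesis
    by (fastforce simp: quot_map_def set_add_def' a_r_coset_def' eq)
qed

context scaled_subgroup
begin

lemma carrier_quot_mod: "carrier (quot_mod M N) = (\<lambda>x. N +> x) ` carrier M"
  by (auto simp: quot_mod_def A_RCOSETS_def')

lemma zero_quot_mod: "\<zero>\<^bsub>quot_mod M N\<^esub> = N"
  by (simp add: quot_mod_def)

lemma add_quot_mod:
  assumes "x \<in> carrier M" "y \<in> carrier M"
  shows "(N +> x) \<oplus>\<^bsub>quot_mod M N\<^esub> (N +> y) = N +> (x \<oplus> y)"
  using a_rcos_sum[OF assms] by (simp add: quot_mod_def)

lemma smult_coset:
  assumes "x \<in> carrier M"
  shows "N <+> (\<lambda>x. r \<odot> x) ` (N +> x) = N +> (r \<odot> x)"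
  using quot_map_coset[of N M N M "\<lambda>x. r \<odot> x" x] assms
  by (simp add: scaled_subgroup_axioms smult_closed smult_add smult_in quot_map_def image_subset_iff)

lemma smult_quot_mod:
  assumes "x \<in> carrier M"
  shows "r \<odot>\<^bsub>quot_mod M N\<^esub> (N +> x) = N +> (r \<odot> x)"
  using smult_coset[OF assms] by (simp add: quot_mod_def)

lemma scaled_group_quot_mod: "scaled_group (quot_mod M N)"
proof -
  have zero: "\<zero>\<^bsub>quot_mod M N\<^esub> = N +> \<zero>"
    using a_rcos_const[of \<zero>] by (simp add: zero_quot_mod)
  have "abelian_group (quot_mod M N)"
  proof (rule abelian_groupI)
    fix X assume "X \<in> carrier (quot_mod M N)"
    then obtain x where "x \<in> carrier M" "X = N +> x" by (auto simp: carrier_quot_mod)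
    then show "\<exists>Y\<in>carrier (quot_mod M N). Y \<oplus>\<^bsub>quot_mod M N\<^esub> X = \<zero>\<^bsub>quot_mod M N\<^esub>"
      by (intro bexI[of _ "N +> \<ominus> x"]) (auto simp: carrier_quot_mod add_quot_mod zero l_neg)
  qed (auto simp: carrier_quot_mod add_quot_mod zero a_ac)
  then show ?thesis
    by (auto simp: scaled_group_def scaled_group_axioms_def carrier_quot_mod smult_quot_mod
      add_quot_mod smult_closed smult_add)
qed

end

section \<open>Linear maps and subquotients\<close>

lemma mod_homI:
  assumes "\<And>x. x \<in> carrier M \<Longrightarrow> h x \<in> carrier M'"
    and "\<And>x y. \<lbrakk>x \<in> carrier M; y \<in> carrier M\<rbrakk> \<Longrightarrow> h (x \<oplus>\<^bsub>M\<^esub> y) = h x \<oplus>\<^bsub>M'\<^esub> h y"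
    and "\<And>r x. x \<in> carrier M \<Longrightarrow> h (r \<odot>\<^bsub>M\<^esub> x) = r \<odot>\<^bsub>M'\<^esub> h x"
  shows "h \<in> mod_hom M M'"
  using assms by (simp add: mod_hom_def)

lemma mod_homD:
  assumes "h \<in> mod_hom M M'"
  shows "x \<in> carrier M \<Longrightarrow> h x \<in> carrier M'"
    and "\<lbrakk>x \<in> carrier M; y \<in> carrier M\<rbrakk> \<Longrightarrow> h (x \<oplus>\<^bsub>M\<^esub> y) = h x \<oplus>\<^bsub>M'\<^esub> h y"
    and "x \<in> carrier M \<Longrightarrow> h (r \<odot>\<^bsub>M\<^esub> x) = r \<odot>\<^bsub>M'\<^esub> h x"
  using assms by (auto simp: mod_hom_def)

lemma mod_hom_zero_minus:
  assumes "h \<in> mod_hom M M'" "abelian_group M" "abelian_group M'"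
  shows "h \<zero>\<^bsub>M\<^esub> = \<zero>\<^bsub>M'\<^esub>"
    and "x \<in> carrier M \<Longrightarrow> h (\<ominus>\<^bsub>M\<^esub> x) = \<ominus>\<^bsub>M'\<^esub> h x"
    and "\<lbrakk>x \<in> carrier M; y \<in> carrier M\<rbrakk> \<Longrightarrow> h (x \<ominus>\<^bsub>M\<^esub> y) = h x \<ominus>\<^bsub>M'\<^esub> h y"
proof -
  interpret abelian_group_hom M M' h
    using mod_homD(1,2)[OF assms(1)] assms(2,3)
    by (intro abelian_group_homI)
      (auto simp: group_hom_def group_hom_axioms_def hom_def abelian_group.a_group)
  show "h \<zero>\<^bsub>M\<^esub> = \<zero>\<^bsub>M'\<^esub>" by simp
  show "x \<in> carrier M \<Longrightarrow> h (\<ominus>\<^bsub>M\<^esub> x) = \<ominus>\<^bsub>M'\<^esub> h x" by simp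
  show "\<lbrakk>x \<in> carrier M; y \<in> carrier M\<rbrakk> \<Longrightarrow> h (x \<ominus>\<^bsub>M\<^esub> y) = h x \<ominus>\<^bsub>M'\<^esub> h y"
    by (simp add: a_minus_def)
qed

lemma scaled_subgroupI:
  fixes M (structure)
  assumes "scaled_group M" "N \<subseteq> carrier M" "\<zero> \<in> N"
    and "\<And>x y. \<lbrakk>x \<in> N; y \<in> N\<rbrakk> \<Longrightarrow> x \<oplus> y \<in> N"
    and "\<And>x. x \<in> N \<Longrightarrow> \<ominus> x \<in> N"
    and "\<And>r x. x \<in> N \<Longrightarrow> r \<odot> x \<in> N"
  shows "scaled_subgroup N M"
proof -
  interpret scaled_group M by fact
  have "subgroup N (add_monoid M)"
    using assms by (intro add.subgroupI) auto
  with assms show ?thesis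
    by (simp add: scaled_subgroup_def scaled_subgroup_axioms_def additive_subgroup_def)
qed

lemma scaled_subgroup_carrier: "scaled_group M \<Longrightarrow> scaled_subgroup (carrier M) M"
  by (intro scaled_subgroupI)
    (auto simp: scaled_group_def scaled_group_axioms_def abelian_group_def
      abelian_monoid.zero_closed abelian_monoid.a_closed abelian_group.a_inv_closed)

text \<open>Two submodules arise in this form: path chains, as the allowed chains with allowed
  boundary, and cubical cycles, where \<open>N'\<close> is the zero submodule.\<close>

lemma scaled_subgroup_vimage:
  assumes "h \<in> mod_hom M M'" "scaled_subgroup N M" "scaled_subgroup N' M'"
  shows "scaled_subgroup {x \<in> N. h x \<in> N'} M"
proof -
  interpret N: scaled_subgroup N M by fact
  interpret N': scaled_subgroup N' M' by fact
  note mod_hom_zero_minus[OF assms(1) N.abelian_group_axioms N'.abelian_group_axioms]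
  then show ?thesis
    using mod_homD[OF assms(1)]
    by (intro scaled_subgroupI) (auto simp: N.scaled_group_axioms N.smult_in N'.smult_in)
qed

lemma scaled_subgroup_image:
  assumes "h \<in> mod_hom M M'" "scaled_subgroup N M" "scaled_group M'"
  shows "scaled_subgroup (h ` N) M'"
proof -
  interpret N: scaled_subgroup N M by fact
  interpret M': scaled_group M' by fact
  note mod_hom_zero_minus[OF assms(1) N.abelian_group_axioms M'.abelian_group_axioms, symmetric]
  with mod_homD[OF assms(1)] mod_homD(2,3)[OF assms(1), symmetric] show ?thesis
    by (intro scaled_subgroupI) (auto simp: M'.scaled_group_axioms N.smult_in)
qed

lemma scaled_subgroup_zero: "scaled_group M \<Longrightarrow> scaled_subgroup {\<zero>\<^bsub>M\<^esub>} M"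
proof -
  assume "scaled_group M"
  then interpret scaled_group M .
  have "r \<odot>\<^bsub>M\<^esub> \<zero>\<^bsub>M\<^esub> = \<zero>\<^bsub>M\<^esub>" for r
    using smult_add[of "\<zero>\<^bsub>M\<^esub>" "\<zero>\<^bsub>M\<^esub>" r] by (simp add: smult_closed)
  then show ?thesis by (intro scaled_subgroupI scaled_group_axioms) auto
qed

lemma quot_map_mod_hom:
  assumes "scaled_subgroup N M" "scaled_subgroup N' M'" "h \<in> mod_hom M M'" "h ` N \<subseteq> N'"
  shows "quot_map M' N' h \<in> mod_hom (quot_mod M N) (quot_mod M' N')"
proof -
  interpret N: scaled_subgroup N M by fact
  interpret N': scaled_subgroup N' M' by fact
  note h = mod_homD[OF assms(3)]
  have "quot_map M' N' h (N +>\<^bsub>M\<^esub> x) = N' +>\<^bsub>M'\<^esub> h x" if "x \<in> carrier M" for x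
    using assms h that by (intro quot_map_coset) auto
  then show ?thesis
    by (intro mod_homI)
      (auto simp: N.carrier_quot_mod N'.carrier_quot_mod N.add_quot_mod N'.add_quot_mod
        N.smult_quot_mod N'.smult_quot_mod h N.smult_closed)
qed

text \<open>Sums of sets and cosets read only the addition of the record. Restricting the carrier to
  cycles, or passing from \<open>CTuple\<close> to \<open>CPath\<close>, therefore changes neither
  cosets nor induced maps.\<close>

lemma set_add_carrier_update [simp]: "X <+>\<^bsub>M\<lparr>carrier := Z\<rparr>\<^esub> Y = X <+>\<^bsub>M\<^esub> Y"
  by (simp add: set_add_def')

lemma a_r_coset_carrier_update [simp]: "X +>\<^bsub>M\<lparr>carrier := Z\<rparr>\<^esub> x = X +>\<^bsub>M\<^esub> x"
  by (simp add: a_r_coset_def')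

lemma quot_map_carrier_update [simp]: "quot_map (M\<lparr>carrier := Z\<rparr>) N = quot_map M N"
  by (simp add: quot_map_def fun_eq_iff)

lemma quot_mod_carrier_update:
  "quot_mod (M\<lparr>carrier := Z\<rparr>) N = (quot_mod M N)\<lparr>carrier := (\<lambda>z. N +>\<^bsub>M\<^esub> z) ` Z\<rparr>"
  by (auto simp: quot_mod_def A_RCOSETS_def')

text \<open>The carrier of the restricted quotient consists of the cosets of \<open>B\<close>
  through elements of \<open>Z\<close>, a subset of M/B, so the map from M/B to M'/B' restricts to
  it. For injectivity, two elements of \<open>Z\<close> with the same image class differ by an
  element of \<open>Z\<close> that \<open>h\<close> sends into \<open>B'\<close>, hence by an
  element of \<open>B\<close>. Cycles in the role of \<open>Z\<close> and boundaries in that of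
  \<open>B\<close> give \<open>psi_star\<close>.\<close>

lemma quot_map_subquotient:
  assumes B: "scaled_subgroup B M" and B': "scaled_subgroup B' M'"
    and Z: "Z \<subseteq> carrier M" and Z': "Z' \<subseteq> carrier M'"
    and h: "h \<in> mod_hom M M'" and hZ: "h ` Z \<subseteq> Z'" and hB: "h ` B \<subseteq> B'"
  shows "quot_map M' B' h
      \<in> mod_hom (quot_mod (M\<lparr>carrier := Z\<rparr>) B) (quot_mod (M'\<lparr>carrier := Z'\<rparr>) B')" (is ?hom)
    and "z \<in> Z \<Longrightarrow> quot_map M' B' h (B +>\<^bsub>M\<^esub> z) = B' +>\<^bsub>M'\<^esub> h z"
    and "h ` Z = Z' \<Longrightarrow> quot_map M' B' h ` carrier (quot_mod (M\<lparr>carrier := Z\<rparr>) B)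
      = carrier (quot_mod (M'\<lparr>carrier := Z'\<rparr>) B')" (is "_ \<Longrightarrow> ?surj")
    and "\<lbrakk>h ` Z = Z'; scaled_subgroup Z M; \<And>z. \<lbrakk>z \<in> Z; h z \<in> B'\<rbrakk> \<Longrightarrow> z \<in> B\<rbrakk> \<Longrightarrow> quot_map M' B' h
      \<in> mod_iso (quot_mod (M\<lparr>carrier := Z\<rparr>) B) (quot_mod (M'\<lparr>carrier := Z'\<rparr>) B')"
proof -
  interpret B: scaled_subgroup B M by fact
  interpret B': scaled_subgroup B' M' by fact
  have coset: "quot_map M' B' h (B +>\<^bsub>M\<^esub> z) = B' +>\<^bsub>M'\<^esub> h z" if "z \<in> Z" for z
    using assms mod_homD[OF h] that by (intro quot_map_coset) auto
  then show "z \<in> Z \<Longrightarrow> quot_map M' B' h (B +>\<^bsub>M\<^esub> z) = B' +>\<^bsub>M'\<^esub> h z" .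
  have sub: "(\<lambda>z. B +>\<^bsub>M\<^esub> z) ` Z \<subseteq> carrier (quot_mod M B)"
    using Z by (auto simp: B.carrier_quot_mod)
  note quot_hom = mod_homD[OF quot_map_mod_hom[OF B B' h hB]]
  show hom: ?hom
  proof (rule mod_homI)
    fix X assume "X \<in> carrier (quot_mod (M\<lparr>carrier := Z\<rparr>) B)"
    then show "quot_map M' B' h X \<in> carrier (quot_mod (M'\<lparr>carrier := Z'\<rparr>) B')"
      using hZ by (auto simp: quot_mod_carrier_update coset)
  qed (use sub quot_hom(2,3) in \<open>simp_all add: quot_mod_carrier_update subset_iff\<close>)
  show surj: ?surj if "h ` Z = Z'"
    unfolding that[symmetric] by (auto simp: quot_mod_carrier_update image_image coset)
  assume hZ': "h ` Z = Z'" and "scaled_subgroup Z M"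
    and inj: "\<And>z. \<lbrakk>z \<in> Z; h z \<in> B'\<rbrakk> \<Longrightarrow> z \<in> B"
  interpret Z: scaled_subgroup Z M by fact
  have "B +>\<^bsub>M\<^esub> z = B +>\<^bsub>M\<^esub> w" if "z \<in> Z" "w \<in> Z" "B' +>\<^bsub>M'\<^esub> h z = B' +>\<^bsub>M'\<^esub> h w" for z w
  proof -
    have "h (z \<ominus>\<^bsub>M\<^esub> w) \<in> B'"
      using that mod_homD(1)[OF h] mod_hom_zero_minus(3)[OF h B.abelian_group_axioms B'.abelian_group_axioms]
      by (simp add: B'.coset_eq_iff)
    then have "z \<ominus>\<^bsub>M\<^esub> w \<in> B" using that by (intro inj) (auto simp: a_minus_def)
    then show ?thesis using that by (simp add: B.coset_eq_iff)
  qed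
  note eq = this
  have "inj_on (quot_map M' B' h) (carrier (quot_mod (M\<lparr>carrier := Z\<rparr>) B))"
  proof (rule inj_onI)
    fix X Y assume "X \<in> carrier (quot_mod (M\<lparr>carrier := Z\<rparr>) B)"
      "Y \<in> carrier (quot_mod (M\<lparr>carrier := Z\<rparr>) B)"
    then obtain z w where zw: "z \<in> Z" "X = B +>\<^bsub>M\<^esub> z" "w \<in> Z" "Y = B +>\<^bsub>M\<^esub> w"
      by (auto simp: quot_mod_carrier_update)
    assume "quot_map M' B' h X = quot_map M' B' h Y"
    then show "X = Y"
      using zw eq[OF zw(1,3)] by (simp only: zw(2,4) coset[OF zw(1)] coset[OF zw(3)])
  qed
  with hom surj[OF hZ'] show "quot_map M' B' h
      \<in> mod_iso (quot_mod (M\<lparr>carrier := Z\<rparr>) B) (quot_mod (M'\<lparr>carrier := Z'\<rparr>) B')"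
    by (simp add: mod_iso_def bij_betw_def)
qed

section \<open>Free modules\<close>

lemma lookup_pm_scale [simp]: "Poly_Mapping.lookup (pm_scale r c) x = r * Poly_Mapping.lookup c x"
  unfolding pm_scale_def by transfer (simp add: when_def)

lemma pm_scale_simps [simp]:
  "pm_scale r 0 = 0" "pm_scale 0 c = 0" "pm_scale 1 c = c" "pm_scale (- r) c = - pm_scale r c"
  "pm_scale r (Poly_Mapping.single x s) = Poly_Mapping.single x (r * s)"
  by (auto intro!: poly_mapping_eqI simp: lookup_single when_def)

lemma pm_scale_linear:
  "pm_scale r (c + d) = pm_scale r c + pm_scale r d"
  "pm_scale r (c - d) = pm_scale r c - pm_scale r d"
  "pm_scale (r + s) c = pm_scale r c + pm_scale s c"
  "pm_scale (r * s) c = pm_scale r (pm_scale s c)"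
  by (auto intro!: poly_mapping_eqI simp: lookup_add lookup_minus algebra_simps)

lemma pm_scale_uminus [simp]: "pm_scale r (- c) = - pm_scale r c"
  by (rule poly_mapping_eqI) simp

lemma pm_scale_sum: "pm_scale r (\<Sum>x\<in>A. f x) = (\<Sum>x\<in>A. pm_scale r (f x))"
  by (rule poly_mapping_eqI) (simp add: lookup_sum sum_distrib_left)

lemma pm_scale_power [simp]: "pm_scale ((- 1) ^ i) c = (if even i then c else - c)"
  by (induction i) simp_all

lemma mem_free_mod: "c \<in> carrier (free_mod S) \<longleftrightarrow> (\<forall>x. x \<notin> S \<longrightarrow> Poly_Mapping.lookup c x = 0)"
  by (auto simp: free_mod_def in_keys_iff)

lemma free_mod_simps [simp]:
  "\<zero>\<^bsub>free_mod S\<^esub> = 0" "c \<oplus>\<^bsub>free_mod S\<^esub> d = c + d" "r \<odot>\<^bsub>free_mod S\<^esub> c = pm_scale r c"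
  by (simp_all add: free_mod_def)

lemma free_mod_closed:
  "0 \<in> carrier (free_mod S)"
  "\<lbrakk>c \<in> carrier (free_mod S); d \<in> carrier (free_mod S)\<rbrakk> \<Longrightarrow> c + d \<in> carrier (free_mod S)"
  "\<lbrakk>c \<in> carrier (free_mod S); d \<in> carrier (free_mod S)\<rbrakk> \<Longrightarrow> c - d \<in> carrier (free_mod S)"
  "c \<in> carrier (free_mod S) \<Longrightarrow> - c \<in> carrier (free_mod S)"
  "c \<in> carrier (free_mod S) \<Longrightarrow> pm_scale r c \<in> carrier (free_mod S)"
  "x \<in> S \<Longrightarrow> Poly_Mapping.single x r \<in> carrier (free_mod S)"
  by (auto simp: mem_free_mod lookup_add lookup_minus lookup_single when_def)

lemma free_mod_sum_closed:
  "(\<And>x. x \<in> A \<Longrightarrow> f x \<in> carrier (free_mod S)) \<Longrightarrow> (\<Sum>x\<in>A. f x) \<in> carrier (free_mod S)"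
  by (induction A rule: infinite_finite_induct) (auto intro: free_mod_closed)

lemma free_mod_mono: "S \<subseteq> T \<Longrightarrow> carrier (free_mod S) \<subseteq> carrier (free_mod T)"
  by (auto simp: free_mod_def)

lemma scaled_group_free_mod: "scaled_group (free_mod S)"
proof -
  have "abelian_group (free_mod S)"
    by (rule abelian_groupI) (auto simp: free_mod_closed ac_simps intro!: bexI[of _ "- x" for x])
  then show ?thesis
    by (simp add: scaled_group_def scaled_group_axioms_def free_mod_closed pm_scale_linear)
qed

lemma free_mod_a_inv: "c \<in> carrier (free_mod S) \<Longrightarrow> \<ominus>\<^bsub>free_mod S\<^esub> c = - c"
  using abelian_group.minus_equality[of "free_mod S" "- c" c] scaled_group_free_mod[of S]
  by (auto simp: scaled_group_def free_mod_closed)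

lemma free_mod_a_minus:
  "d \<in> carrier (free_mod S) \<Longrightarrow> c \<ominus>\<^bsub>free_mod S\<^esub> d = c - d"
  by (simp add: a_minus_def free_mod_a_inv)

lemma scaled_subgroup_free_mod:
  assumes "T \<subseteq> S"
  shows "scaled_subgroup (carrier (free_mod T)) (free_mod S)"
proof (rule scaled_subgroupI[OF scaled_group_free_mod free_mod_mono[OF assms]])
  fix c :: "'a \<Rightarrow>\<^sub>0 'b" assume "c \<in> carrier (free_mod T)"
  then show "\<ominus>\<^bsub>free_mod S\<^esub> c \<in> carrier (free_mod T)"
    using free_mod_mono[OF assms] by (subst free_mod_a_inv) (auto intro: free_mod_closed)
qed (auto simp: free_mod_closed)

lemma free_mod_Un:
  assumes "c \<in> carrier (free_mod (S \<union> T))"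
  obtains d e where "d \<in> carrier (free_mod S)" "e \<in> carrier (free_mod T)" "c = e + d"
proof -
  let ?part = "\<lambda>A. \<Sum>x\<in>A. Poly_Mapping.single x (Poly_Mapping.lookup c x)"
  let ?K = "Poly_Mapping.keys c"
  have "Poly_Mapping.lookup c y = Poly_Mapping.lookup (?part (?K - S) + ?part (?K \<inter> S)) y" for y
    by (auto simp: lookup_add lookup_sum lookup_single when_def in_keys_iff sum.delta)
  then have "c = ?part (?K - S) + ?part (?K \<inter> S)" by (rule poly_mapping_eqI)
  moreover have "?part (?K \<inter> S) \<in> carrier (free_mod S)"
    by (auto intro!: free_mod_sum_closed free_mod_closed)
  moreover have "?part (?K - S) \<in> carrier (free_mod T)"
    using assms by (intro free_mod_sum_closed free_mod_closed(6)) (auto simp: free_mod_def)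
  ultimately show ?thesis using that by blast
qed

section \<open>Linear extension from generators\<close>

lemma lin_ext_superset:
  assumes "finite A" "Poly_Mapping.keys c \<subseteq> A"
  shows "lin_ext g c = (\<Sum>x\<in>A. pm_scale (Poly_Mapping.lookup c x) (g x))"
  unfolding lin_ext_def using assms by (intro sum.mono_neutral_left) (auto simp: in_keys_iff)

lemma lin_ext_add: "lin_ext g (c + d) = lin_ext g c + lin_ext g d"
proof -
  let ?A = "Poly_Mapping.keys c \<union> Poly_Mapping.keys d"
  have "Poly_Mapping.keys (c + d) \<subseteq> ?A" by (rule keys_add)
  then show ?thesis
    by (simp add: lin_ext_superset[of ?A] lookup_add pm_scale_linear sum.distrib)
qed

lemma lin_ext_scale: "lin_ext g (pm_scale r c) = pm_scale r (lin_ext g c)"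
proof -
  have "Poly_Mapping.keys (pm_scale r c) \<subseteq> Poly_Mapping.keys c"
    by (auto simp: in_keys_iff)
  then show ?thesis
    by (simp add: lin_ext_superset[of "Poly_Mapping.keys c"] pm_scale_linear pm_scale_sum)
qed

lemma lin_ext_single [simp]: "lin_ext g (Poly_Mapping.single x r) = pm_scale r (g x)"
  by (subst lin_ext_superset[of "{x}"]) auto

lemma lin_ext_zero [simp]: "lin_ext g 0 = 0"
  by (simp add: lin_ext_def)

lemma lin_ext_uminus: "lin_ext g (- c) = - lin_ext g c"
  using lin_ext_scale[of g "- 1" c] by simp

lemma lin_ext_diff: "lin_ext g (c - d) = lin_ext g c - lin_ext g d"
  using lin_ext_add[of g c "- d"] by (simp add: lin_ext_uminus)

lemma lin_ext_sum: "lin_ext g (\<Sum>x\<in>A. f x) = (\<Sum>x\<in>A. lin_ext g (f x))"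
  by (induction A rule: infinite_finite_induct) (simp_all add: lin_ext_add)

lemma lin_ext_lin_ext: "lin_ext f (lin_ext g c) = lin_ext (\<lambda>x. lin_ext f (g x)) c"
  unfolding lin_ext_def[of g] lin_ext_def[of "\<lambda>x. lin_ext f (g x)"]
  by (simp add: lin_ext_sum lin_ext_scale)

lemma lin_ext_diff_fun: "lin_ext (\<lambda>x. f x - g x) c = lin_ext f c - lin_ext g c"
  by (simp add: lin_ext_def pm_scale_linear sum_subtractf)

lemma lin_ext_unit: "lin_ext (\<lambda>x. Poly_Mapping.single x 1) c = c"
  by (rule poly_mapping_eqI)
    (simp add: lin_ext_def lookup_sum lookup_single when_def in_keys_iff if_distrib cong: if_cong)

lemma lin_ext_cong:
  assumes "c \<in> carrier (free_mod S)" "\<And>x. x \<in> S \<Longrightarrow> f x = g x"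
  shows "lin_ext f c = lin_ext g c"
  using assms by (auto simp: lin_ext_def free_mod_def intro!: sum.cong)

lemma lin_ext_closed:
  assumes "c \<in> carrier (free_mod S)" "\<And>x. x \<in> S \<Longrightarrow> g x \<in> carrier (free_mod T)"
  shows "lin_ext g c \<in> carrier (free_mod T)"
  unfolding lin_ext_def using assms
  by (intro free_mod_sum_closed free_mod_closed) (auto simp: free_mod_def)

lemma lin_ext_mod_hom:
  assumes "\<And>x. x \<in> S \<Longrightarrow> g x \<in> carrier (free_mod T)"
  shows "lin_ext g \<in> mod_hom (free_mod S) (free_mod T)"
  using assms by (intro mod_homI) (auto simp: lin_ext_add lin_ext_scale intro: lin_ext_closed)

lemma lookup_lin_ext:
  "Poly_Mapping.lookup (lin_ext g c) y
    = (\<Sum>x\<in>Poly_Mapping.keys c. Poly_Mapping.lookup c x * Poly_Mapping.lookup (g x) y)"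
  by (simp add: lin_ext_def lookup_sum)

section \<open>Cubes\<close>

text \<open>Adjacency with a loop added at every vertex: the relation that graph homomorphisms
  preserve. A tuple whose steps are all weakly adjacent is either allowed or degenerate.\<close>

definition weakly_adjacent :: "'a ugraph \<Rightarrow> 'a \<Rightarrow> 'a \<Rightarrow> bool" where
  "weakly_adjacent G u v \<longleftrightarrow> u = v \<or> {u, v} \<in> edges G"

lemma weakly_adjacent_sym: "weakly_adjacent G u v \<longleftrightarrow> weakly_adjacent G v u"
  by (auto simp: weakly_adjacent_def insert_commute)

lemma verts_hypercube [simp]: "verts (hypercube n) = {a. length a = n}"
  by (simp add: hypercube_def verts_def)

lemma edge_hypercube_iff:
  assumes "length u = n" "length v = n"
  shows "{u, v} \<in> edges (hypercube n) \<longleftrightarrow> (\<exists>j<n. v = u[j := \<not> u ! j])"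
proof -
  have sym: "{i. i < n \<and> u ! i \<noteq> v ! i} = {i. i < n \<and> v ! i \<noteq> u ! i}" by auto
  have "{u, v} \<in> edges (hypercube n) \<longleftrightarrow> (\<exists>u' v'. {u, v} = {u', v'} \<and> length u' = n \<and> length v' = n \<and>
      card {i. i < n \<and> u' ! i \<noteq> v' ! i} = 1)"
    by (simp add: hypercube_def edges_def)
  also have "\<dots> \<longleftrightarrow> card {i. i < n \<and> u ! i \<noteq> v ! i} = 1"
  proof
    assume "\<exists>u' v'. {u, v} = {u', v'} \<and> length u' = n \<and> length v' = n \<and>
      card {i. i < n \<and> u' ! i \<noteq> v' ! i} = 1"
    then obtain u' v' where "{u, v} = {u', v'}" and c: "card {i. i < n \<and> u' ! i \<noteq> v' ! i} = 1"
      by blast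
    then consider "u' = u" "v' = v" | "u' = v" "v' = u" by (auto simp: doubleton_eq_iff)
    then show "card {i. i < n \<and> u ! i \<noteq> v ! i} = 1" using c sym by cases simp_all
  qed (use assms in blast)
  also have "\<dots> \<longleftrightarrow> (\<exists>j<n. v = u[j := \<not> u ! j])"
  proof
    assume "card {i. i < n \<and> u ! i \<noteq> v ! i} = 1"
    then obtain j where "{i. i < n \<and> u ! i \<noteq> v ! i} = {j}"
      by (auto simp: card_1_singleton_iff)
    then have j: "i < n \<and> u ! i \<noteq> v ! i \<longleftrightarrow> i = j" for i by blast
    have "v ! i = u[j := \<not> u ! j] ! i" if "i < length v" for i
      using j[of i] that assms by (cases "i = j") auto
    then have "v = u[j := \<not> u ! j]"
      using assms by (intro nth_equalityI) auto
    with j show "\<exists>j<n. v = u[j := \<not> u ! j]" by blast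
  next
    assume "\<exists>j<n. v = u[j := \<not> u ! j]"
    then obtain j where "j < n" "v = u[j := \<not> u ! j]" by blast
    with assms have "{i. i < n \<and> u ! i \<noteq> v ! i} = {j}" by (auto simp: nth_list_update)
    then show "card {i. i < n \<and> u ! i \<noteq> v ! i} = 1" by simp
  qed
  finally show ?thesis .
qed

text \<open>Edges of the hypercube are flips of one coordinate. The condition ranges over both
  values of \<open>b\<close>, as setting a coordinate to its present value changes nothing and weak
  adjacency is reflexive; no negated entry has to be carried along.\<close>

lemma mem_sing_cubes:
  "\<sigma> \<in> sing_cubes G n \<longleftrightarrow> \<sigma> \<in> extensional {a. length a = n} \<and>
     (\<forall>a. length a = n \<longrightarrow> \<sigma> a \<in> verts G) \<and>
     (\<forall>a j b. length a = n \<longrightarrow> j < n \<longrightarrow> weakly_adjacent G (\<sigma> a) (\<sigma> (a[j := b])))" (is "?L \<longleftrightarrow> ?R")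
proof
  assume L: ?L
  have "weakly_adjacent G (\<sigma> a) (\<sigma> (a[j := b]))" if "length a = n" "j < n" for a j b
  proof (cases "b = a ! j")
    case True
    then show ?thesis by (simp add: weakly_adjacent_def)
  next
    case False
    then have "b = (\<not> a ! j)" by simp
    with that have "{a, a[j := b]} \<in> edges (hypercube n)"
      by (subst edge_hypercube_iff) auto
    with L that show ?thesis by (auto simp: sing_cubes_def graph_hom_def weakly_adjacent_def)
  qed
  with L show ?R by (auto simp: sing_cubes_def graph_hom_def)
next
  assume R: ?R
  then show ?L
    unfolding sing_cubes_def graph_hom_def
    by (auto simp: edge_hypercube_iff) (auto simp: weakly_adjacent_def)
qed

text \<open>Insertion at position \<open>i\<close> moves the coordinates from \<open>i\<close> on up
  by one. A coordinate change in a face thereby becomes a coordinate change in the cube.\<close>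

lemma insert_update:
  assumes "j < length a" "i \<le> length a"
  shows "take i (a[j := b]) @ e # drop i (a[j := b])
    = (take i a @ e # drop i a)[(if j < i then j else Suc j) := b]"
  using assms
  by (auto simp: list_update_append drop_update_swap take_update_swap Suc_diff_le list_update_beyond)

lemma face_apply:
  "length a = n - 1 \<Longrightarrow> face n i e \<sigma> a = \<sigma> (take (i - 1) a @ e # drop (i - 1) a)"
  by (simp add: face_def)

lemma face_update:
  assumes "length a = n - 1" "i \<in> {1..n}" "j < n - 1"
  shows "face n i e \<sigma> (a[j := b])
    = \<sigma> ((take (i - 1) a @ e # drop (i - 1) a)[(if j < i - 1 then j else Suc j) := b])"
proof -
  have "i - 1 \<le> length a" "j < length a" using assms by auto
  then show ?thesis
    using assms(1) by (metis (no_types) face_apply insert_update length_list_update)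
qed

lemma face_sing_cubes:
  assumes "\<sigma> \<in> sing_cubes G n" "i \<in> {1..n}"
  shows "face n i e \<sigma> \<in> sing_cubes G (n - 1)"
  unfolding mem_sing_cubes
proof (intro conjI allI impI)
  show "face n i e \<sigma> \<in> extensional {a. length a = n - 1}" by (simp add: face_def)
  show "face n i e \<sigma> a \<in> verts G" if "length a = n - 1" for a
    using assms that by (auto simp: face_apply mem_sing_cubes)
  show "weakly_adjacent G (face n i e \<sigma> a) (face n i e \<sigma> (a[j := b]))"
    if "length a = n - 1" "j < n - 1" for a j b
    unfolding face_apply[OF that(1)] face_update[OF that(1) assms(2) that(2)]
    using assms that by (auto simp: mem_sing_cubes)
qed

text \<open>Faces count coordinates from 1 and lists from 0, hence \<open>Suc j\<close>. Degeneracy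
  becomes independence of coordinate \<open>j\<close>, a form that is easily traced through faces in
  other directions.\<close>

lemma opposite_faces_eq_iff:
  assumes "j < n"
  shows "face n (Suc j) True \<sigma> = face n (Suc j) False \<sigma> \<longleftrightarrow>
      (\<forall>a. length a = n \<longrightarrow> \<sigma> (a[j := True]) = \<sigma> (a[j := False]))" (is "?L \<longleftrightarrow> ?R")
proof
  assume L: ?L
  show ?R
  proof (intro allI impI)
    fix a :: "bool list" assume a: "length a = n"
    let ?a = "take j a @ drop (Suc j) a"
    have len: "length ?a = n - 1" using a assms by simp
    have "\<sigma> (a[j := b]) = face n (Suc j) b \<sigma> ?a" for b
      using face_apply[OF len, of "Suc j" b \<sigma>] a assms by (simp add: upd_conv_take_nth_drop)
    with L show "\<sigma> (a[j := True]) = \<sigma> (a[j := False])" by simp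
  qed
next
  assume R: ?R
  have "\<sigma> (take j a @ True # drop j a) = \<sigma> (take j a @ False # drop j a)" if a: "length a = n - 1" for a
    using R[rule_format, of "take j a @ True # drop j a"] a assms
    by (simp add: list_update_append)
  then show ?L by (auto simp: face_def fun_eq_iff)
qed

lemma degenerate_cubes_iff:
  "\<sigma> \<in> degenerate_cubes G n \<longleftrightarrow> \<sigma> \<in> sing_cubes G n \<and>
     (\<exists>j<n. \<forall>a. length a = n \<longrightarrow> \<sigma> (a[j := True]) = \<sigma> (a[j := False]))"
proof -
  have "{1..n} = Suc ` {..<n}" by (simp add: image_Suc_lessThan)
  then have "(\<exists>i\<in>{1..n}. face n i True \<sigma> = face n i False \<sigma>) \<longleftrightarrow>
      (\<exists>j<n. face n (Suc j) True \<sigma> = face n (Suc j) False \<sigma>)" by auto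
  then show ?thesis by (auto simp: degenerate_cubes_def opposite_faces_eq_iff)
qed

lemma cube_boundary_closed:
  "\<sigma> \<in> sing_cubes G n \<Longrightarrow> cube_boundary n \<sigma> \<in> carrier (free_mod (sing_cubes G (n - 1)))"
  unfolding cube_boundary_def
  by (intro free_mod_sum_closed free_mod_closed face_sing_cubes) auto

text \<open>Fixing another coordinate leaves the cube independent of coordinate \<open>j\<close>,
  which is renumbered to \<open>j - 1\<close> in the face if it lies behind the fixed one.\<close>

lemma degenerate_face:
  assumes \<sigma>: "\<sigma> \<in> sing_cubes G n" and i: "i \<in> {1..n}" "i \<noteq> Suc j" and j: "j < n"
    and eq: "\<And>a. length a = n \<Longrightarrow> \<sigma> (a[j := True]) = \<sigma> (a[j := False])"
  shows "face n i e \<sigma> \<in> degenerate_cubes G (n - 1)"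
  unfolding degenerate_cubes_iff
proof
  show "face n i e \<sigma> \<in> sing_cubes G (n - 1)" using \<sigma> i(1) by (rule face_sing_cubes)
  let ?j = "if j < i - 1 then j else j - 1"
  have j': "?j < n - 1" and j'': "(if ?j < i - 1 then ?j else Suc ?j) = j"
    using i j by auto
  have "face n i e \<sigma> (a[?j := True]) = face n i e \<sigma> (a[?j := False])" if "length a = n - 1" for a
    unfolding face_update[OF that i(1) j'] j'' using that i by (intro eq) auto
  with j' show "\<exists>j<n - 1. \<forall>a. length a = n - 1 \<longrightarrow>
      face n i e \<sigma> (a[j := True]) = face n i e \<sigma> (a[j := False])" by blast
qed

text \<open>In a direction where the opposite faces agree, the two terms cancel; in every other
  direction both faces are degenerate.\<close>

lemma cube_boundary_degenerate:
  assumes "\<sigma> \<in> degenerate_cubes G n"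
  shows "cube_boundary n \<sigma> \<in> carrier (free_mod (degenerate_cubes G (n - 1)))"
  unfolding cube_boundary_def
proof (intro free_mod_sum_closed)
  fix i assume i: "i \<in> {1..n}"
  show "pm_scale ((- 1) ^ i) (Poly_Mapping.single (face n i False \<sigma>) 1 -
      Poly_Mapping.single (face n i True \<sigma>) 1) \<in> carrier (free_mod (degenerate_cubes G (n - 1)))"
  proof (cases "face n i True \<sigma> = face n i False \<sigma>")
    case True
    then show ?thesis by (simp add: free_mod_closed)
  next
    case False
    obtain j where "j < n" "\<And>a. length a = n \<Longrightarrow> \<sigma> (a[j := True]) = \<sigma> (a[j := False])"
      using assms by (auto simp: degenerate_cubes_iff)
    moreover from this False have "i \<noteq> Suc j"
      using opposite_faces_eq_iff[of j n \<sigma>] by auto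
    ultimately have "face n i e \<sigma> \<in> degenerate_cubes G (n - 1)" for e
      using assms i by (intro degenerate_face) (auto simp: degenerate_cubes_def)
    then show ?thesis by (intro free_mod_closed)
  qed
qed

section \<open>Tuples\<close>

abbreviation delete_nth :: "nat \<Rightarrow> 'a list \<Rightarrow> 'a list" where
  "delete_nth i t \<equiv> take i t @ drop (Suc i) t"

lemma nth_delete_nth:
  "\<lbrakk>i < length t; k < length t - 1\<rbrakk> \<Longrightarrow> delete_nth i t ! k = t ! (if k < i then k else Suc k)"
  by (simp add: nth_append min_def)

lemma delete_nth_tuples:
  assumes "t \<in> tuples V n" "i \<le> n" "n > 0"
  shows "delete_nth i t \<in> tuples V (n - 1)"
  using assms by (auto simp: tuples_def dest: in_set_takeD in_set_dropD)

lemma tuple_boundary_closed: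
  assumes "t \<in> tuples V n"
  shows "tuple_boundary n t \<in> carrier (free_mod (tuples V (n - 1)))"
  using delete_nth_tuples[OF assms] unfolding tuple_boundary_def
  by (auto intro!: free_mod_sum_closed free_mod_closed simp del: pm_scale_power)

lemma degenerate_delete_nth:
  assumes "t \<in> tuples V n" "i \<le> n" "k < n" "t ! k = t ! Suc k" "i \<noteq> k" "i \<noteq> Suc k"
  shows "delete_nth i t \<in> degenerate_tuples V (n - 1)"
proof -
  let ?k = "if k < i then k else k - 1"
  have "delete_nth i t ! ?k = delete_nth i t ! Suc ?k" "?k < n - 1"
    using assms by (auto simp: nth_delete_nth tuples_def)
  then show ?thesis
    using delete_nth_tuples[of t V n i] assms unfolding degenerate_tuples_def by blast
qed

text \<open>If entries \<open>k\<close> and \<open>k + 1\<close> agree, deleting either gives the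
  same tuple with opposite signs, and every other deletion keeps the repeated pair.\<close>

lemma tuple_boundary_degenerate:
  assumes "t \<in> degenerate_tuples V n"
  shows "tuple_boundary n t \<in> carrier (free_mod (degenerate_tuples V (n - 1)))"
proof -
  obtain k where t: "t \<in> tuples V n" and k: "k < n" "t ! k = t ! Suc k"
    using assms by (auto simp: degenerate_tuples_def)
  let ?f = "\<lambda>i. pm_scale ((- 1) ^ i) (Poly_Mapping.single (delete_nth i t) (1 :: 'b))"
  have "delete_nth k t = delete_nth (Suc k) t"
  proof (intro nth_equalityI)
    fix m assume "m < length (delete_nth k t)"
    with t k show "delete_nth k t ! m = delete_nth (Suc k) t ! m"
      by (cases "m = k") (auto simp: nth_delete_nth tuples_def)
  qed (use t k in \<open>auto simp: tuples_def\<close>)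
  then have "?f k + ?f (Suc k) = 0" by (simp del: pm_scale_simps(5))
  moreover have "(\<Sum>i = 0..n. ?f i) = ?f k + (?f (Suc k) + (\<Sum>i\<in>{0..n} - {k} - {Suc k}. ?f i))"
    using k by (simp add: sum.remove[of _ k] sum.remove[of _ "Suc k"] del: pm_scale_power)
  ultimately have "(\<Sum>i = 0..n. ?f i) = (\<Sum>i\<in>{0..n} - {k} - {Suc k}. ?f i)"
    by (simp add: add.assoc[symmetric] del: pm_scale_power)
  also have "\<dots> \<in> carrier (free_mod (degenerate_tuples V (n - 1)))"
    using t k by (intro free_mod_sum_closed free_mod_closed degenerate_delete_nth) auto
  finally show ?thesis using k by (simp add: tuple_boundary_def)
qed

lemma weakly_adjacent_tuple:
  assumes "t \<in> tuples (verts G) n" "\<And>i. i < n \<Longrightarrow> weakly_adjacent G (t ! i) (t ! Suc i)"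
  shows "t \<in> allowed_paths G n \<union> degenerate_tuples (verts G) n"
  using assms by (auto simp: allowed_paths_def degenerate_tuples_def weakly_adjacent_def)


section \<open>The comparison map on cubes\<close>

text \<open>Vertices are encoded by sets of coordinates, counted from 1, so that the path of \<tau>
  is the chain of images of \<open>{1..k}\<close> under \<tau> and claims about paths become claims
  about images of intervals.\<close>

definition cube_vertex :: "nat \<Rightarrow> nat set \<Rightarrow> bool list" where
  "cube_vertex n A = map (\<lambda>j. j \<in> A) [1..<Suc n]"

lemma length_cube_vertex [simp]: "length (cube_vertex n A) = n"
  by (simp add: cube_vertex_def)

lemma nth_cube_vertex: "j < n \<Longrightarrow> cube_vertex n A ! j \<longleftrightarrow> Suc j \<in> A"
  unfolding cube_vertex_def by (subst nth_map) (simp_all del: upt_Suc)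

lemma perm_path_eq: "perm_path n \<tau> k = cube_vertex n (\<tau> ` {1..k})"
  by (simp add: perm_path_def cube_vertex_def)

lemma cube_vertex_update:
  assumes "Suc j \<notin> A"
  shows "cube_vertex n A = (cube_vertex n A)[j := False]"
    and "cube_vertex n (insert (Suc j) A) = (cube_vertex n A)[j := True]"
proof -
  have "(cube_vertex n A)[j := b] ! i \<longleftrightarrow> (if i = j then b else Suc i \<in> A)" if "i < n" for i b
    using that by (simp add: nth_list_update nth_cube_vertex)
  with assms show "cube_vertex n A = (cube_vertex n A)[j := False]"
      "cube_vertex n (insert (Suc j) A) = (cube_vertex n A)[j := True]"
    by (auto intro!: nth_equalityI simp: nth_cube_vertex split: if_splits)
qed

abbreviation signed :: "(nat \<Rightarrow> nat) \<Rightarrow> 'b::ab_group_add \<Rightarrow> 'b" where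
  "signed \<tau> c \<equiv> (if evenperm \<tau> then c else - c)"

definition cube_path :: "nat \<Rightarrow> 'a cube \<Rightarrow> (nat \<Rightarrow> nat) \<Rightarrow> 'a list" where
  "cube_path n \<sigma> \<tau> = map (\<lambda>k. \<sigma> (cube_vertex n (\<tau> ` {1..k}))) [0..<Suc n]"

lemma length_cube_path [simp]: "length (cube_path n \<sigma> \<tau>) = Suc n"
  by (simp add: cube_path_def)

lemma nth_cube_path: "k \<le> n \<Longrightarrow> cube_path n \<sigma> \<tau> ! k = \<sigma> (cube_vertex n (\<tau> ` {1..k}))"
  unfolding cube_path_def by (subst nth_map) (simp_all del: upt_Suc)

lemma psi_cube_eq:
  "psi_cube n \<sigma> = (\<Sum>\<tau> | \<tau> permutes {1..n}. signed \<tau> (Poly_Mapping.single (cube_path n \<sigma> \<tau>) 1))"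
  unfolding psi_cube_def perm_path_eq cube_path_def
  by (intro sum.cong) (auto simp: single_uminus)

lemma cube_path_tuples:
  assumes "\<sigma> \<in> sing_cubes G n"
  shows "cube_path n \<sigma> \<tau> \<in> tuples (verts G) n"
  using assms unfolding tuples_def cube_path_def by (auto simp: mem_sing_cubes)

text \<open>Both ends of the step are written as updates of one vertex, although the first update
  changes nothing. In this form weak adjacency and degeneracy of the cube apply directly.\<close>

lemma cube_path_step:
  assumes "\<tau> permutes {1..n}" "k < n"
  obtains j where "\<tau> (Suc k) = Suc j" "j < n"
    "cube_path n \<sigma> \<tau> ! k = \<sigma> ((cube_vertex n (\<tau> ` {1..k}))[j := False])"
    "cube_path n \<sigma> \<tau> ! Suc k = \<sigma> ((cube_vertex n (\<tau> ` {1..k}))[j := True])"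
proof -
  have "\<tau> (Suc k) \<in> {1..n}" using assms permutes_in_image[OF assms(1), of "Suc k"] by simp
  then obtain j where j: "\<tau> (Suc k) = Suc j" "j < n" by (cases "\<tau> (Suc k)") auto
  have notin: "Suc j \<notin> \<tau> ` {1..k}"
    using inj_image_mem_iff[OF permutes_inj[OF assms(1)], of "Suc k" "{1..k}"] by (simp add: j(1))
  have "\<tau> ` {1..Suc k} = insert (Suc j) (\<tau> ` {1..k})"
    by (simp add: atLeastAtMostSuc_conv j(1))
  then show ?thesis
    using that[OF j] cube_vertex_update[OF notin, of n] assms(2) by (simp add: nth_cube_path)
qed

lemma cube_path_weakly_adjacent:
  assumes "\<sigma> \<in> sing_cubes G n" "\<tau> permutes {1..n}" "k < n"
  shows "weakly_adjacent G (cube_path n \<sigma> \<tau> ! k) (cube_path n \<sigma> \<tau> ! Suc k)"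
proof -
  let ?a = "cube_vertex n (\<tau> ` {1..k})"
  obtain j where j: "j < n" "cube_path n \<sigma> \<tau> ! k = \<sigma> (?a[j := False])"
    "cube_path n \<sigma> \<tau> ! Suc k = \<sigma> (?a[j := True])"
    using assms(2,3) by (rule cube_path_step)
  have "weakly_adjacent G (\<sigma> (?a[j := False])) (\<sigma> ((?a[j := False])[j := True]))"
    using assms(1) j(1) unfolding mem_sing_cubes by (metis length_cube_vertex length_list_update)
  with j show ?thesis by simp
qed

lemma psi_cube_closed:
  assumes "\<sigma> \<in> sing_cubes G n"
  shows "psi_cube n \<sigma> \<in> carrier (free_mod (allowed_paths G n \<union> degenerate_tuples (verts G) n))"
  unfolding psi_cube_eq
proof (rule free_mod_sum_closed)
  fix \<tau> assume "\<tau> \<in> {\<tau>. \<tau> permutes {1..n}}"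
  with assms have "cube_path n \<sigma> \<tau> \<in> allowed_paths G n \<union> degenerate_tuples (verts G) n"
    by (intro weakly_adjacent_tuple cube_path_tuples cube_path_weakly_adjacent) auto
  then show "signed \<tau> (Poly_Mapping.single (cube_path n \<sigma> \<tau>) 1)
      \<in> carrier (free_mod (allowed_paths G n \<union> degenerate_tuples (verts G) n))"
    by (simp add: free_mod_closed)
qed

text \<open>Every path flips each coordinate at some step. At the step that flips the coordinate on
  which the cube does not depend, the image path repeats a vertex.\<close>

lemma psi_cube_degenerate:
  assumes "\<sigma> \<in> degenerate_cubes G n"
  shows "psi_cube n \<sigma> \<in> carrier (free_mod (degenerate_tuples (verts G) n))"
  unfolding psi_cube_eq
proof (rule free_mod_sum_closed)
  fix \<tau> assume "\<tau> \<in> {\<tau>. \<tau> permutes {1..n}}"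
  then have \<tau>: "\<tau> permutes {1..n}" by simp
  obtain j where \<sigma>: "\<sigma> \<in> sing_cubes G n" and "j < n"
    and eq: "\<And>a. length a = n \<Longrightarrow> \<sigma> (a[j := True]) = \<sigma> (a[j := False])"
    using assms by (auto simp: degenerate_cubes_iff)
  then have "Suc j \<in> \<tau> ` {1..n}" using permutes_image[OF \<tau>] by simp
  then obtain m where "m \<in> {1..n}" "\<tau> m = Suc j" by (metis imageE)
  then obtain k where k: "k < n" "\<tau> (Suc k) = Suc j" by (cases m) (auto simp: Suc_le_eq)
  obtain j' where "\<tau> (Suc k) = Suc j'"
    "cube_path n \<sigma> \<tau> ! k = \<sigma> ((cube_vertex n (\<tau> ` {1..k}))[j' := False])"
    "cube_path n \<sigma> \<tau> ! Suc k = \<sigma> ((cube_vertex n (\<tau> ` {1..k}))[j' := True])"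
    using \<tau> k(1) by (rule cube_path_step)
  with k eq have "cube_path n \<sigma> \<tau> \<in> degenerate_tuples (verts G) n"
    using cube_path_tuples[OF \<sigma>] by (auto simp: degenerate_tuples_def)
  then show "signed \<tau> (Poly_Mapping.single (cube_path n \<sigma> \<tau>) 1)
      \<in> carrier (free_mod (degenerate_tuples (verts G) n))"
    by (simp add: free_mod_closed)
qed

section \<open>Signed sums over permutations\<close>

definition signed_sum :: "nat set \<Rightarrow> ((nat \<Rightarrow> nat) \<Rightarrow> 'b::ab_group_add) \<Rightarrow> 'b" where
  "signed_sum S f = (\<Sum>\<tau> | \<tau> permutes S. signed \<tau> (f \<tau>))"

lemma permutation_if_permutes_interval: "\<tau> permutes {a..b::nat} \<Longrightarrow> permutation \<tau>"
  by (rule permutes_imp_permutation) auto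

lemma signed_sum_cong:
  "(\<And>\<tau>. \<tau> permutes S \<Longrightarrow> f \<tau> = g \<tau>) \<Longrightarrow> signed_sum S f = signed_sum S g"
  unfolding signed_sum_def by (intro sum.cong) auto

text \<open>Composition with the transposition is a sign-reversing involution on the permutations.
  Matching even with odd terms gives zero over any ring, including those of characteristic
  2.\<close>

lemma signed_sum_invariant_transpose:
  fixes f :: "(nat \<Rightarrow> nat) \<Rightarrow> 'b::ab_group_add"
  assumes "a \<in> S" "b \<in> S" "a \<noteq> b" "finite S"
    and inv: "\<And>\<tau>. \<tau> permutes S \<Longrightarrow> f (\<tau> \<circ> transpose a b) = f \<tau>"
  shows "signed_sum S f = 0"
proof -
  have t: "transpose a b permutes S" using assms by (intro permutes_swap_id)
  have even: "evenperm (\<tau> \<circ> transpose a b) \<longleftrightarrow> \<not> evenperm \<tau>" if "\<tau> permutes S" for \<tau>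
    using that assms
    by (subst evenperm_comp) (auto simp: evenperm_swap permutation_swap_id intro: permutes_imp_permutation)
  have "(\<Sum>\<tau> | \<tau> permutes S \<and> \<not> evenperm \<tau>. - f \<tau>) = (\<Sum>\<tau> | \<tau> permutes S \<and> evenperm \<tau>. - f \<tau>)"
    by (rule sum.reindex_bij_witness[of _ "\<lambda>\<tau>. \<tau> \<circ> transpose a b" "\<lambda>\<tau>. \<tau> \<circ> transpose a b"])
      (auto simp: even permutes_compose[OF t] inv comp_assoc)
  moreover have "signed_sum S f = (\<Sum>\<tau> | \<tau> permutes S \<and> evenperm \<tau>. f \<tau>) + (\<Sum>\<tau> | \<tau> permutes S \<and> \<not> evenperm \<tau>. - f \<tau>)"
    unfolding signed_sum_def using finite_permutations[OF \<open>finite S\<close>]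
    by (subst sum.If_cases) (auto simp: Int_def conj_commute)
  ultimately show ?thesis by (simp add: sum_negf)
qed

lemma signed_sum_compose_right:
  assumes "r permutes S" "finite S"
  shows "signed_sum S (\<lambda>\<tau>. f (\<tau> \<circ> r)) = signed r (signed_sum S f)"
proof -
  have "signed \<tau> (f (\<tau> \<circ> r)) = signed r (signed (\<tau> \<circ> r) (f (\<tau> \<circ> r)))" if "\<tau> permutes S" for \<tau>
    using evenperm_comp[of \<tau> r] permutes_imp_permutation[OF assms(2)] that assms(1) by simp
  then have "signed_sum S (\<lambda>\<tau>. f (\<tau> \<circ> r)) = (\<Sum>\<tau> | \<tau> permutes S. signed r (signed (\<tau> \<circ> r) (f (\<tau> \<circ> r))))"
    unfolding signed_sum_def by (intro sum.cong) auto
  also have "\<dots> = (\<Sum>\<tau> | \<tau> permutes S. signed r (signed \<tau> (f \<tau>)))"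
    using sum_permutations_compose_right[OF assms(1), of "\<lambda>\<tau>. signed r (signed \<tau> (f \<tau>))"] by simp
  also have "\<dots> = signed r (signed_sum S f)"
    by (simp add: signed_sum_def sum_negf)
  finally show ?thesis .
qed

text \<open>The cycle (i, i+1, ..., n). On \<open>{1..n-1}\<close> it is the increasing bijection
  onto \<open>{1..n}\<close> without \<open>i\<close>, which is how the coordinates of the i-th face
  sit in the cube; its sign is the source of the signs in the cubical boundary.\<close>

definition shift_cycle :: "nat \<Rightarrow> nat \<Rightarrow> nat \<Rightarrow> nat" where
  "shift_cycle i n j = (if j = n then i else if i \<le> j \<and> j < n then Suc j else j)"

lemma shift_cycle_decompose:
  "i < n \<Longrightarrow> shift_cycle i n = transpose i (Suc i) \<circ> shift_cycle (Suc i) n"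
  by (auto simp: fun_eq_iff shift_cycle_def transpose_def)

text \<open>Descending from \<open>i = n\<close>, where the cycle is the identity, each step
  contributes one adjacent transposition, hence n - i in total.\<close>

lemma shift_cycle_permutes_even:
  assumes "i \<le> n"
  shows "shift_cycle i n permutes {i..n} \<and> (evenperm (shift_cycle i n) \<longleftrightarrow> even (n - i))"
  using assms
proof (induction i rule: inc_induct)
  case base
  have "shift_cycle n n = id" by (auto simp: shift_cycle_def fun_eq_iff)
  then show ?case by (simp only: permutes_id evenperm_id) simp
next
  case (step i)
  have t: "transpose i (Suc i) permutes {i..n}" using step by (intro permutes_swap_id) auto
  have s: "shift_cycle (Suc i) n permutes {i..n}"
    by (rule permutes_subset[OF conjunct1[OF step.IH]]) auto
  have "evenperm (shift_cycle i n) \<longleftrightarrow> \<not> evenperm (shift_cycle (Suc i) n)"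
    unfolding shift_cycle_decompose[OF step(2)]
    using permutation_if_permutes_interval[OF s]
    by (simp add: evenperm_comp permutation_swap_id evenperm_swap)
  moreover have "even (n - i) \<longleftrightarrow> odd (n - Suc i)"
    using step(2) by (metis Suc_diff_Suc even_Suc)
  ultimately show ?case
    using step.IH permutes_compose[OF s t] by (simp only: shift_cycle_decompose[OF step(2)] simp_thms)
qed

lemma
  assumes "i \<in> {1..n}"
  shows shift_cycle_permutes: "shift_cycle i n permutes {1..n}"
    and evenperm_shift_cycle: "evenperm (shift_cycle i n) \<longleftrightarrow> even (n - i)"
  using assms shift_cycle_permutes_even[of i n] by (auto intro: permutes_subset)

text \<open>The analogue of the Laplace expansion of a determinant: a permutation of
  \<open>{1..Suc m}\<close> that sends \<open>Suc m\<close> to \<open>i\<close> is uniquely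
  \<open>shift_cycle i (Suc m)\<close> composed with a permutation of \<open>{1..m}\<close>.\<close>

lemma signed_sum_expand:
  fixes f :: "(nat \<Rightarrow> nat) \<Rightarrow> 'b::ab_group_add"
  shows "signed_sum {1..Suc m} f = (\<Sum>i = 1..Suc m.
    signed (shift_cycle i (Suc m)) (signed_sum {1..m} (\<lambda>\<tau>. f (shift_cycle i (Suc m) \<circ> \<tau>))))"
proof -
  let ?n = "Suc m" and ?g = "\<lambda>\<tau>. signed \<tau> (f \<tau>)"
  have "signed_sum {1..?n} f = (\<Sum>i = 1..?n. \<Sum>\<tau> | \<tau> permutes {1..m}. ?g (transpose ?n i \<circ> \<tau>))"
    using sum_over_permutations_insert[of "{1..m}" ?n ?g]
    by (simp add: signed_sum_def atLeastAtMostSuc_conv)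
  also have "\<dots> = (\<Sum>i = 1..?n. \<Sum>\<tau> | \<tau> permutes {1..m}. ?g (shift_cycle i ?n \<circ> \<tau>))"
  proof (rule sum.cong[OF refl])
    fix i assume i: "i \<in> {1..?n}"
    \<comment> \<open>The expansion so far uses the transpositions of \<open>?n\<close> and
      \<open>i\<close> as coset representatives. \<open>?c\<close> fixes \<open>?n\<close>, so it
      permutes \<open>{1..m}\<close>, and reindexing the inner sum by it exchanges the transposition
      for the cycle.\<close>
    let ?c = "transpose ?n i \<circ> shift_cycle i ?n"
    have "?c permutes {1..?n}"
      using i by (intro permutes_compose shift_cycle_permutes permutes_swap_id) auto
    moreover have "?c ?n = ?n" by (simp add: shift_cycle_def)
    ultimately have c: "?c permutes {1..m}"
      by (elim permutes_superset) (auto simp: le_Suc_eq)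
    have "(\<Sum>\<tau> | \<tau> permutes {1..m}. ?g (transpose ?n i \<circ> \<tau>))
        = (\<Sum>\<tau> | \<tau> permutes {1..m}. ?g (transpose ?n i \<circ> (?c \<circ> \<tau>)))"
      by (rule setum_permutations_compose_left[OF c])
    moreover have "transpose ?n i \<circ> (?c \<circ> \<tau>) = shift_cycle i ?n \<circ> \<tau>" for \<tau> :: "nat \<Rightarrow> nat"
      by (simp add: fun_eq_iff)
    ultimately show "(\<Sum>\<tau> | \<tau> permutes {1..m}. ?g (transpose ?n i \<circ> \<tau>))
        = (\<Sum>\<tau> | \<tau> permutes {1..m}. ?g (shift_cycle i ?n \<circ> \<tau>))"
      by (simp only:)
  qed
  also have "\<dots> = (\<Sum>i = 1..?n. \<Sum>\<tau> | \<tau> permutes {1..m}.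
      signed (shift_cycle i ?n) (signed \<tau> (f (shift_cycle i ?n \<circ> \<tau>))))"
  proof (intro sum.cong refl)
    fix i \<tau> assume i: "i \<in> {1..?n}" and "\<tau> \<in> {\<tau>. \<tau> permutes {1..m}}"
    then have "permutation \<tau>" by (blast intro: permutation_if_permutes_interval)
    moreover have "permutation (shift_cycle i ?n)"
      by (rule permutation_if_permutes_interval[OF shift_cycle_permutes[OF i]])
    ultimately show "?g (shift_cycle i ?n \<circ> \<tau>) = signed (shift_cycle i ?n) (signed \<tau> (f (shift_cycle i ?n \<circ> \<tau>)))"
      by (simp add: evenperm_comp)
  qed
  also have "\<dots> = (\<Sum>i = 1..?n. signed (shift_cycle i ?n) (signed_sum {1..m} (\<lambda>\<tau>. f (shift_cycle i ?n \<circ> \<tau>))))"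
    by (intro sum.cong) (auto simp: signed_sum_def sum_negf)
  finally show ?thesis .
qed


section \<open>The comparison map is a chain map\<close>

text \<open>The image under the cycle of a subset of \<open>{1..m}\<close> misses \<open>i\<close>,
  so coordinate \<open>i\<close> reads False until \<open>i\<close> is added. These are the vertices
  of the two opposite faces in direction \<open>i\<close>.\<close>

lemma cube_vertex_shift_cycle:
  assumes "i \<in> {1..Suc m}" "A \<subseteq> {1..m}"
  shows "cube_vertex (Suc m) (shift_cycle i (Suc m) ` A)
      = take (i - 1) (cube_vertex m A) @ False # drop (i - 1) (cube_vertex m A)"
    and "cube_vertex (Suc m) (insert i (shift_cycle i (Suc m) ` A))
      = take (i - 1) (cube_vertex m A) @ True # drop (i - 1) (cube_vertex m A)"
proof -
  have mem: "Suc j \<in> shift_cycle i (Suc m) ` A \<longleftrightarrow>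
      (if j < i - 1 then Suc j \<in> A else if j = i - 1 then False else j \<in> A)" if "j < Suc m" for j
  proof -
    have "shift_cycle i (Suc m) ` A = (\<lambda>x. if x < i then x else Suc x) ` A"
      using assms by (intro image_cong) (auto simp: shift_cycle_def)
    moreover have "Suc j \<in> (\<lambda>x. if x < i then x else Suc x) ` A \<longleftrightarrow> Suc j < i \<and> Suc j \<in> A \<or> i \<le> j \<and> j \<in> A"
      by (force simp: image_iff)
    ultimately show ?thesis using assms(1) by auto
  qed
  have nth: "(take (i - 1) (cube_vertex m A) @ e # drop (i - 1) (cube_vertex m A)) ! j \<longleftrightarrow>
      (if j < i - 1 then Suc j \<in> A else if j = i - 1 then e else j \<in> A)" if "j < Suc m" for j e
    using that assms(1) by (auto simp: nth_append nth_Cons' nth_cube_vertex min_def)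
  show "cube_vertex (Suc m) (shift_cycle i (Suc m) ` A)
      = take (i - 1) (cube_vertex m A) @ False # drop (i - 1) (cube_vertex m A)"
    using assms(1) by (intro nth_equalityI) (auto simp: nth_cube_vertex mem nth simp del: One_nat_def)
  show "cube_vertex (Suc m) (insert i (shift_cycle i (Suc m) ` A))
      = take (i - 1) (cube_vertex m A) @ True # drop (i - 1) (cube_vertex m A)"
    using assms(1) by (intro nth_equalityI) (auto simp: nth_cube_vertex mem nth simp del: One_nat_def)
qed

text \<open>Swapping steps i and i+1 alters the set of flipped coordinates only after exactly i
  steps, and that vertex is the one deleted.\<close>

lemma delete_inner_cube_path:
  assumes "i \<in> {1..m}"
  shows "delete_nth i (cube_path (Suc m) \<sigma> (\<tau> \<circ> transpose i (Suc i))) = delete_nth i (cube_path (Suc m) \<sigma> \<tau>)"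
proof (rule nth_equalityI)
  show "length (delete_nth i (cube_path (Suc m) \<sigma> (\<tau> \<circ> transpose i (Suc i))))
      = length (delete_nth i (cube_path (Suc m) \<sigma> \<tau>))" by simp
  fix k assume "k < length (delete_nth i (cube_path (Suc m) \<sigma> (\<tau> \<circ> transpose i (Suc i))))"
  then have k: "k \<le> m" using assms by simp
  let ?k = "if k < i then k else Suc k"
  have "transpose i (Suc i) ` {1..?k} = {1..?k}"
    using assms by (intro transpose_image_eq) auto
  then have "(\<tau> \<circ> transpose i (Suc i)) ` {1..?k} = \<tau> ` {1..?k}"
    by (simp only: image_comp[symmetric])
  moreover have "?k \<le> Suc m" using k by simp
  ultimately have "cube_path (Suc m) \<sigma> (\<tau> \<circ> transpose i (Suc i)) ! ?k = cube_path (Suc m) \<sigma> \<tau> ! ?k"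
    by (simp only: nth_cube_path)
  then show "delete_nth i (cube_path (Suc m) \<sigma> (\<tau> \<circ> transpose i (Suc i))) ! k
      = delete_nth i (cube_path (Suc m) \<sigma> \<tau>) ! k"
    using k assms by (simp add: nth_delete_nth)
qed

text \<open>The composed permutation flips coordinate \<open>i\<close> last, so until then the path
  stays in the face where coordinate \<open>i\<close> is 0.\<close>

lemma delete_last_cube_path:
  assumes i: "i \<in> {1..Suc m}" and \<tau>: "\<tau> permutes {1..m}"
  shows "delete_nth (Suc m) (cube_path (Suc m) \<sigma> (shift_cycle i (Suc m) \<circ> \<tau>))
    = cube_path m (face (Suc m) i False \<sigma>) \<tau>"
proof (rule nth_equalityI)
  fix k assume "k < length (delete_nth (Suc m) (cube_path (Suc m) \<sigma> (shift_cycle i (Suc m) \<circ> \<tau>)))"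
  then have k: "k \<le> m" by simp
  then have sub: "\<tau> ` {1..k} \<subseteq> {1..m}" using permutes_image[OF \<tau>] by fastforce
  show "delete_nth (Suc m) (cube_path (Suc m) \<sigma> (shift_cycle i (Suc m) \<circ> \<tau>)) ! k
      = cube_path m (face (Suc m) i False \<sigma>) \<tau> ! k"
    using k cube_vertex_shift_cycle(1)[OF i sub]
    by (simp add: nth_delete_nth nth_cube_path face_apply image_comp del: One_nat_def)
qed simp

text \<open>The path that starts with coordinate \<tau> n already flipped and continues with \<tau>
  1, \<tau> 2, and so on. It describes deletion of the first vertex with the first flip moved to the
  last argument, where \<open>signed_sum_expand\<close> splits permutations.\<close>

definition rotated_path :: "nat \<Rightarrow> 'a cube \<Rightarrow> (nat \<Rightarrow> nat) \<Rightarrow> 'a list" where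
  "rotated_path n \<sigma> \<tau> = map (\<lambda>k. \<sigma> (cube_vertex n (insert (\<tau> n) (\<tau> ` {1..k})))) [0..<n]"

lemma delete_first_cube_path:
  "delete_nth 0 (cube_path (Suc m) \<sigma> \<tau>) = rotated_path (Suc m) \<sigma> (\<tau> \<circ> shift_cycle 1 (Suc m))"
proof (rule nth_equalityI)
  fix k assume "k < length (delete_nth 0 (cube_path (Suc m) \<sigma> \<tau>))"
  then have k: "k \<le> m" by simp
  have "shift_cycle 1 (Suc m) ` {1..k} = Suc ` {1..k}"
    using k by (intro image_cong) (auto simp: shift_cycle_def)
  moreover have "insert 1 (Suc ` {1..k}) = {1..Suc k}"
    by auto
  ultimately have "insert (shift_cycle 1 (Suc m) (Suc m)) (shift_cycle 1 (Suc m) ` {1..k}) = {1..Suc k}"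
    by (simp add: shift_cycle_def)
  then have "insert (\<tau> (shift_cycle 1 (Suc m) (Suc m))) (\<tau> ` shift_cycle 1 (Suc m) ` {1..k}) = \<tau> ` {1..Suc k}"
    by (metis image_insert)
  then show "delete_nth 0 (cube_path (Suc m) \<sigma> \<tau>) ! k
      = rotated_path (Suc m) \<sigma> (\<tau> \<circ> shift_cycle 1 (Suc m)) ! k"
    using k by (simp add: nth_delete_nth nth_cube_path rotated_path_def image_comp del: upt_Suc One_nat_def)
qed (simp add: rotated_path_def)

lemma rotated_path_shift_cycle:
  assumes i: "i \<in> {1..Suc m}" and \<tau>: "\<tau> permutes {1..m}"
  shows "rotated_path (Suc m) \<sigma> (shift_cycle i (Suc m) \<circ> \<tau>) = cube_path m (face (Suc m) i True \<sigma>) \<tau>"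
proof (rule nth_equalityI)
  fix k assume "k < length (rotated_path (Suc m) \<sigma> (shift_cycle i (Suc m) \<circ> \<tau>))"
  then have k: "k \<le> m" by (simp add: rotated_path_def)
  then have sub: "\<tau> ` {1..k} \<subseteq> {1..m}" using permutes_image[OF \<tau>] by fastforce
  have "shift_cycle i (Suc m) (\<tau> (Suc m)) = i"
    using permutes_not_in[OF \<tau>, of "Suc m"] by (simp add: shift_cycle_def)
  then show "rotated_path (Suc m) \<sigma> (shift_cycle i (Suc m) \<circ> \<tau>) ! k
      = cube_path m (face (Suc m) i True \<sigma>) \<tau> ! k"
    using k cube_vertex_shift_cycle(2)[OF i sub]
    by (simp add: rotated_path_def nth_cube_path face_apply image_comp del: upt_Suc One_nat_def)
qed (simp add: rotated_path_def)

lemma psi_cube_signed_sum: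
  "psi_cube n \<sigma> = signed_sum {1..n} (\<lambda>\<tau>. Poly_Mapping.single (cube_path n \<sigma> \<tau>) 1)"
  by (simp add: psi_cube_eq signed_sum_def)

lemma signed_sum_pm_scale: "signed_sum S (\<lambda>\<tau>. pm_scale r (f \<tau>)) = pm_scale r (signed_sum S f)"
  unfolding signed_sum_def pm_scale_sum by (intro sum.cong) auto

lemma signed_sum_sum: "signed_sum S (\<lambda>\<tau>. \<Sum>x\<in>A. f x \<tau>) = (\<Sum>x\<in>A. signed_sum S (f x))"
proof -
  have "signed \<tau> (\<Sum>x\<in>A. f x \<tau>) = (\<Sum>x\<in>A. signed \<tau> (f x \<tau>))" for \<tau>
    by (simp add: sum_negf)
  then show ?thesis unfolding signed_sum_def by (simp only: sum.swap[of _ A])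
qed

lemma lin_ext_signed_sum: "lin_ext g (signed_sum S f) = signed_sum S (\<lambda>\<tau>. lin_ext g (f \<tau>))"
  unfolding signed_sum_def lin_ext_sum by (intro sum.cong) (auto simp: lin_ext_uminus)

text \<open>Exchanging the sums leaves \<open>S i\<close>, the signed sum of all paths with vertex i
  deleted. \<open>S n\<close> is expanded by the coordinate flipped last, which gives the faces at
  0. \<open>S 0\<close>, after rotation, is expanded by the coordinate flipped first, which gives
  the faces at 1.\<close>

lemma psi_cube_boundary:
  fixes \<sigma> :: "'a cube"
  shows "lin_ext (tuple_boundary n) (psi_cube n \<sigma>)
    = (lin_ext (psi_cube (n - 1)) (cube_boundary n \<sigma>) :: 'a list \<Rightarrow>\<^sub>0 'r::{comm_ring,comm_monoid_mult})"
proof (cases n)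
  case 0
  then show ?thesis by (simp add: cube_boundary_def lin_ext_def tuple_boundary_def)
next
  case (Suc m)
  let ?psi = "\<lambda>i e. psi_cube m (face n i e \<sigma>) :: 'a list \<Rightarrow>\<^sub>0 'r"
  define S :: "nat \<Rightarrow> 'a list \<Rightarrow>\<^sub>0 'r" where
    "S i = signed_sum {1..n} (\<lambda>\<tau>. Poly_Mapping.single (delete_nth i (cube_path n \<sigma> \<tau>)) 1)" for i
  have inner: "S i = 0" if "i \<in> {1..m}" for i
    unfolding S_def using that
    by (intro signed_sum_invariant_transpose[of i _ "Suc i"]) (auto simp: Suc delete_inner_cube_path)
  have last: "S n = (\<Sum>i = 1..n. pm_scale ((- 1) ^ (n - i)) (?psi i False))"
    unfolding S_def Suc signed_sum_expand
  proof (intro sum.cong refl)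
    fix i assume i: "i \<in> {1..Suc m}"
    have "signed_sum {1..m} (\<lambda>\<tau>. Poly_Mapping.single (delete_nth (Suc m)
        (cube_path (Suc m) \<sigma> (shift_cycle i (Suc m) \<circ> \<tau>))) 1)
        = (psi_cube m (face (Suc m) i False \<sigma>) :: 'a list \<Rightarrow>\<^sub>0 'r)"
      unfolding psi_cube_signed_sum
      by (intro signed_sum_cong arg_cong2[of _ _ _ _ Poly_Mapping.single] delete_last_cube_path i) auto
    then show "signed (shift_cycle i (Suc m)) (signed_sum {1..m} (\<lambda>\<tau>. Poly_Mapping.single
        (delete_nth (Suc m) (cube_path (Suc m) \<sigma> (shift_cycle i (Suc m) \<circ> \<tau>))) 1))
        = pm_scale ((- 1) ^ (Suc m - i)) (psi_cube m (face (Suc m) i False \<sigma>) :: 'a list \<Rightarrow>\<^sub>0 'r)"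
      by (simp only: evenperm_shift_cycle[OF i] pm_scale_power cong del: if_weak_cong)
  qed
  have "S 0 = signed_sum {1..n} (\<lambda>\<tau>. Poly_Mapping.single (rotated_path n \<sigma> (\<tau> \<circ> shift_cycle 1 n)) 1)"
    unfolding S_def Suc delete_first_cube_path ..
  also have "\<dots> = signed (shift_cycle 1 n) (signed_sum {1..n} (\<lambda>\<tau>. Poly_Mapping.single (rotated_path n \<sigma> \<tau>) 1))"
    using Suc by (intro signed_sum_compose_right shift_cycle_permutes) auto
  also have "\<dots> = pm_scale ((- 1) ^ m) (signed_sum {1..n} (\<lambda>\<tau>. Poly_Mapping.single (rotated_path n \<sigma> \<tau>) 1))"
    using evenperm_shift_cycle[of 1 n] Suc by (simp only: pm_scale_power) simp
  also have "signed_sum {1..n} (\<lambda>\<tau>. Poly_Mapping.single (rotated_path n \<sigma> \<tau>) 1)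
      = (\<Sum>i = 1..n. pm_scale ((- 1) ^ (n - i)) (?psi i True))"
    unfolding Suc signed_sum_expand
  proof (intro sum.cong refl)
    fix i assume i: "i \<in> {1..Suc m}"
    have "signed_sum {1..m} (\<lambda>\<tau>. Poly_Mapping.single
        (rotated_path (Suc m) \<sigma> (shift_cycle i (Suc m) \<circ> \<tau>)) 1)
        = (psi_cube m (face (Suc m) i True \<sigma>) :: 'a list \<Rightarrow>\<^sub>0 'r)"
      unfolding psi_cube_signed_sum
      by (intro signed_sum_cong arg_cong2[of _ _ _ _ Poly_Mapping.single] rotated_path_shift_cycle i) auto
    then show "signed (shift_cycle i (Suc m)) (signed_sum {1..m} (\<lambda>\<tau>. Poly_Mapping.single
        (rotated_path (Suc m) \<sigma> (shift_cycle i (Suc m) \<circ> \<tau>)) 1))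
        = pm_scale ((- 1) ^ (Suc m - i)) (psi_cube m (face (Suc m) i True \<sigma>) :: 'a list \<Rightarrow>\<^sub>0 'r)"
      by (simp only: evenperm_shift_cycle[OF i] pm_scale_power cong del: if_weak_cong)
  qed
  finally have first: "S 0 = pm_scale ((- 1) ^ m) (\<Sum>i = 1..n. pm_scale ((- 1) ^ (n - i)) (?psi i True))" .
  have "lin_ext (tuple_boundary n) (psi_cube n \<sigma>) = signed_sum {1..n} (\<lambda>\<tau>. \<Sum>i = 0..n.
      pm_scale ((- 1) ^ i) (Poly_Mapping.single (delete_nth i (cube_path n \<sigma> \<tau>)) (1 :: 'r)))"
    by (simp only: Suc psi_cube_signed_sum lin_ext_signed_sum lin_ext_single tuple_boundary_def
        pm_scale_simps(3) nat.distinct if_False)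
  also have "\<dots> = (\<Sum>i = 0..n. pm_scale ((- 1) ^ i) (S i))"
    by (simp only: signed_sum_sum signed_sum_pm_scale S_def)
  also have "\<dots> = S 0 + (\<Sum>i = 1..m. pm_scale ((- 1) ^ i) (S i)) + pm_scale ((- 1) ^ n) (S n)"
    unfolding Suc by (simp add: sum.atLeast_Suc_atMost del: pm_scale_power)
  also have "(\<Sum>i = 1..m. pm_scale ((- 1) ^ i) (S i)) = 0"
    by (intro sum.neutral) (simp add: inner)
  \<comment> \<open>The face at 0 in direction i carries (-1)^n (-1)^(n-i) = (-1)^i. The face at 1
    carries (-1)^m (-1)^(n-i), where (-1)^m is the sign of the rotation; as n = m + 1, this is
    -(-1)^i.\<close>
  also have "S 0 + 0 + pm_scale ((- 1) ^ n) (S n)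
      = (\<Sum>i = 1..n. pm_scale ((- 1) ^ i) (?psi i False - ?psi i True))"
    unfolding first last pm_scale_sum add_0_right sum.distrib[symmetric]
    using Suc by (intro sum.cong) auto
  also have "\<dots> = lin_ext (psi_cube (n - 1)) (cube_boundary n \<sigma>)"
    using Suc by (simp add: cube_boundary_def lin_ext_sum lin_ext_scale lin_ext_diff del: pm_scale_power)
  finally show ?thesis .
qed

section \<open>Chains modulo degenerate chains\<close>

abbreviation cube_class :: "'a ugraph \<Rightarrow> nat \<Rightarrow> ('a cube \<Rightarrow>\<^sub>0 'r::{comm_ring,comm_monoid_mult}) \<Rightarrow> ('a, 'r) cube_chain" where
  "cube_class G n c \<equiv> degenerate_cube_chains G n +>\<^bsub>free_mod (sing_cubes G n)\<^esub> c"

abbreviation tuple_class :: "'a set \<Rightarrow> nat \<Rightarrow> ('a list \<Rightarrow>\<^sub>0 'r::{comm_ring,comm_monoid_mult}) \<Rightarrow> ('a, 'r) path_chain" where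
  "tuple_class V n c \<equiv> degenerate_tuple_chains V n +>\<^bsub>free_mod (tuples V n)\<^esub> c"

lemma degenerate_cube_subgroup:
  "scaled_subgroup (degenerate_cube_chains G n) (free_mod (sing_cubes G n))"
  unfolding degenerate_cube_chains_def
  by (rule scaled_subgroup_free_mod) (auto simp: degenerate_cubes_def)

lemma degenerate_tuple_subgroup:
  "scaled_subgroup (degenerate_tuple_chains V n) (free_mod (tuples V n))"
  unfolding degenerate_tuple_chains_def
  by (rule scaled_subgroup_free_mod) (auto simp: degenerate_tuples_def)

lemmas scaled_group_CCube =
  scaled_subgroup.scaled_group_quot_mod[OF degenerate_cube_subgroup, folded CCube_def]
lemmas scaled_group_CTuple =
  scaled_subgroup.scaled_group_quot_mod[OF degenerate_tuple_subgroup, folded CTuple_def]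
lemmas carrier_CCube =
  scaled_subgroup.carrier_quot_mod[OF degenerate_cube_subgroup, folded CCube_def]

lemma cube_class_eq_iff:
  assumes "c \<in> carrier (free_mod (sing_cubes G n))" "d \<in> carrier (free_mod (sing_cubes G n))"
  shows "cube_class G n c = cube_class G n d \<longleftrightarrow> c - d \<in> degenerate_cube_chains G n"
  using scaled_subgroup.coset_eq_iff[OF degenerate_cube_subgroup assms] assms
  by (simp add: free_mod_a_minus)

lemma tuple_class_eq_iff:
  assumes "c \<in> carrier (free_mod (tuples V n))" "d \<in> carrier (free_mod (tuples V n))"
  shows "tuple_class V n c = tuple_class V n d \<longleftrightarrow> c - d \<in> degenerate_tuple_chains V n"
  using scaled_subgroup.coset_eq_iff[OF degenerate_tuple_subgroup assms] assms
  by (simp add: free_mod_a_minus)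

lemma
  shows dCube_hom: "dCube G n \<in> mod_hom (CCube G n) (CCube G (n - 1))"
    and dCube_class: "c \<in> carrier (free_mod (sing_cubes G n)) \<Longrightarrow>
      dCube G n (cube_class G n c) = cube_class G (n - 1) (lin_ext (cube_boundary n) c)"
proof -
  have hom: "lin_ext (cube_boundary n) \<in> mod_hom (free_mod (sing_cubes G n)) (free_mod (sing_cubes G (n - 1)))"
    by (intro lin_ext_mod_hom cube_boundary_closed)
  have N: "lin_ext (cube_boundary n) ` degenerate_cube_chains G n \<subseteq> degenerate_cube_chains G (n - 1)"
    unfolding degenerate_cube_chains_def
    by (intro image_subsetI lin_ext_closed[OF _ cube_boundary_degenerate])
  show "dCube G n \<in> mod_hom (CCube G n) (CCube G (n - 1))"
    unfolding dCube_def CCube_def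
    by (intro quot_map_mod_hom degenerate_cube_subgroup hom N)
  show "c \<in> carrier (free_mod (sing_cubes G n)) \<Longrightarrow>
      dCube G n (cube_class G n c) = cube_class G (n - 1) (lin_ext (cube_boundary n) c)"
    unfolding dCube_def using mod_homD[OF hom]
    by (intro quot_map_coset degenerate_cube_subgroup N) auto
qed

lemma
  shows dTuple_hom: "dTuple V n \<in> mod_hom (CTuple V n) (CTuple V (n - 1))"
    and dTuple_class: "c \<in> carrier (free_mod (tuples V n)) \<Longrightarrow>
      dTuple V n (tuple_class V n c) = tuple_class V (n - 1) (lin_ext (tuple_boundary n) c)"
proof -
  have hom: "lin_ext (tuple_boundary n) \<in> mod_hom (free_mod (tuples V n)) (free_mod (tuples V (n - 1)))"
    by (intro lin_ext_mod_hom tuple_boundary_closed)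
  have N: "lin_ext (tuple_boundary n) ` degenerate_tuple_chains V n \<subseteq> degenerate_tuple_chains V (n - 1)"
    unfolding degenerate_tuple_chains_def
    by (intro image_subsetI lin_ext_closed[OF _ tuple_boundary_degenerate])
  show "dTuple V n \<in> mod_hom (CTuple V n) (CTuple V (n - 1))"
    unfolding dTuple_def CTuple_def
    by (intro quot_map_mod_hom degenerate_tuple_subgroup hom N)
  show "c \<in> carrier (free_mod (tuples V n)) \<Longrightarrow>
      dTuple V n (tuple_class V n c) = tuple_class V (n - 1) (lin_ext (tuple_boundary n) c)"
    unfolding dTuple_def using mod_homD[OF hom]
    by (intro quot_map_coset degenerate_tuple_subgroup N) auto
qed

lemma weak_paths_subset: "allowed_paths G n \<union> degenerate_tuples (verts G) n \<subseteq> tuples (verts G) n"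
  by (auto simp: allowed_paths_def degenerate_tuples_def)

lemma psi_cube_tuples:
  "\<sigma> \<in> sing_cubes G n \<Longrightarrow> psi_cube n \<sigma> \<in> carrier (free_mod (tuples (verts G) n))"
  by (rule subsetD[OF free_mod_mono[OF weak_paths_subset] psi_cube_closed])

lemma
  shows psi_CTuple_hom: "psi G n \<in> mod_hom (CCube G n) (CTuple (verts G) n)"
    and psi_class: "c \<in> carrier (free_mod (sing_cubes G n)) \<Longrightarrow>
      psi G n (cube_class G n c) = tuple_class (verts G) n (lin_ext (psi_cube n) c)"
proof -
  have hom: "lin_ext (psi_cube n) \<in> mod_hom (free_mod (sing_cubes G n)) (free_mod (tuples (verts G) n))"
    by (intro lin_ext_mod_hom psi_cube_tuples)
  have N: "lin_ext (psi_cube n) ` degenerate_cube_chains G n \<subseteq> degenerate_tuple_chains (verts G) n"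
    unfolding degenerate_tuple_chains_def degenerate_cube_chains_def
    by (intro image_subsetI lin_ext_closed[OF _ psi_cube_degenerate])
  show "psi G n \<in> mod_hom (CCube G n) (CTuple (verts G) n)"
    unfolding psi_def CTuple_def CCube_def
    by (intro quot_map_mod_hom degenerate_cube_subgroup degenerate_tuple_subgroup hom N)
  show "c \<in> carrier (free_mod (sing_cubes G n)) \<Longrightarrow>
      psi G n (cube_class G n c) = tuple_class (verts G) n (lin_ext (psi_cube n) c)"
    unfolding psi_def using mod_homD[OF hom]
    by (intro quot_map_coset degenerate_cube_subgroup degenerate_tuple_subgroup N) auto
qed

lemma psi_chain_map:
  assumes "x \<in> carrier (CCube G n)"
  shows "psi G (n - 1) (dCube G n x) = dTuple (verts G) n (psi G n x)"
proof -
  obtain c where c: "c \<in> carrier (free_mod (sing_cubes G n))" "x = cube_class G n c"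
    using assms by (auto simp: carrier_CCube)
  have "lin_ext (cube_boundary n) c \<in> carrier (free_mod (sing_cubes G (n - 1)))"
    using c(1) by (rule lin_ext_closed) (rule cube_boundary_closed)
  moreover have "lin_ext (psi_cube n) c \<in> carrier (free_mod (tuples (verts G) n))"
    using c(1) by (rule lin_ext_closed) (rule psi_cube_tuples)
  ultimately show ?thesis
    using c by (simp add: dCube_class psi_class dTuple_class lin_ext_lin_ext psi_cube_boundary)
qed

text \<open>Allowed chains are defined by the existence of a suitable representative; here any
  representative can be tested by its support. This turns an allowed boundary into the vanishing of
  coefficients.\<close>

lemma tuple_class_allowed_iff:
  assumes "c \<in> carrier (free_mod (tuples (verts G) n))"
  shows "tuple_class (verts G) n c \<in> allowed_chains G n \<longleftrightarrow>
    c \<in> carrier (free_mod (allowed_paths G n \<union> degenerate_tuples (verts G) n))" (is "?L \<longleftrightarrow> ?R")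
proof
  note sub = free_mod_mono[of "allowed_paths G n" "allowed_paths G n \<union> degenerate_tuples (verts G) n"]
    free_mod_mono[of "degenerate_tuples (verts G) n" "allowed_paths G n \<union> degenerate_tuples (verts G) n"]
    free_mod_mono[OF weak_paths_subset, of G n]
  {
    assume ?L
    then obtain d where d: "d \<in> carrier (free_mod (allowed_paths G n))"
      "tuple_class (verts G) n c = tuple_class (verts G) n d"
      by (auto simp: allowed_chains_def)
    moreover from d(1) have "d \<in> carrier (free_mod (tuples (verts G) n))" using sub by blast
    ultimately have "c - d \<in> carrier (free_mod (degenerate_tuples (verts G) n))"
      using assms by (simp add: tuple_class_eq_iff flip: degenerate_tuple_chains_def)
    then have "(c - d) + d \<in> carrier (free_mod (allowed_paths G n \<union> degenerate_tuples (verts G) n))"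
      using d(1) sub by (intro free_mod_closed(2)) auto
    then show ?R by simp
  next
    assume ?R
    then obtain d e where d: "d \<in> carrier (free_mod (allowed_paths G n))"
      "e \<in> carrier (free_mod (degenerate_tuples (verts G) n))" "c = e + d"
      by (rule free_mod_Un)
    moreover from d(1) have "d \<in> carrier (free_mod (tuples (verts G) n))" using sub by blast
    ultimately have "tuple_class (verts G) n c = tuple_class (verts G) n d"
      using assms by (simp add: tuple_class_eq_iff flip: degenerate_tuple_chains_def)
    with d(1) show ?L by (simp add: allowed_chains_def)
  }
qed

lemma allowed_chains_subgroup: "scaled_subgroup (allowed_chains G n) (CTuple (verts G) n)"
  unfolding allowed_chains_def
proof (rule scaled_subgroup_image)
  show "tuple_class (verts G) n \<in> mod_hom (free_mod (tuples (verts G) n)) (CTuple (verts G) n)"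
    by (intro mod_homI) (simp_all add: CTuple_def
        scaled_subgroup.carrier_quot_mod[OF degenerate_tuple_subgroup]
        scaled_subgroup.add_quot_mod[OF degenerate_tuple_subgroup, simplified]
        scaled_subgroup.smult_quot_mod[OF degenerate_tuple_subgroup, simplified])
  show "scaled_subgroup (carrier (free_mod (allowed_paths G n))) (free_mod (tuples (verts G) n))"
    by (rule scaled_subgroup_free_mod) (auto simp: allowed_paths_def)
  show "scaled_group (CTuple (verts G) n)" by (rule scaled_group_CTuple)
qed

lemma carrier_CPath:
  "carrier (CPath G n) = {x \<in> allowed_chains G n. dTuple (verts G) n x \<in> allowed_chains G (n - 1)}"
  by (simp add: CPath_def)

lemma CPath_subgroup: "scaled_subgroup (carrier (CPath G n)) (CTuple (verts G) n)"
  unfolding carrier_CPath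
  by (intro scaled_subgroup_vimage[OF dTuple_hom] allowed_chains_subgroup)

text \<open>The boundary of the image is the image of the boundary, so allowedness of images in
  degrees n and n - 1 gives both defining conditions.\<close>

lemma psi_closed:
  fixes x :: "('a, 'r::{comm_ring,comm_monoid_mult}) cube_chain"
  assumes "x \<in> carrier (CCube G n)"
  shows "psi G n x \<in> carrier (CPath G n)"
proof -
  have allowed: "psi G m y \<in> allowed_chains G m" if "y \<in> carrier (CCube G m)" for m and y :: "('a, 'r) cube_chain"
  proof -
    obtain c where c: "c \<in> carrier (free_mod (sing_cubes G m))" "y = cube_class G m c"
      using \<open>y \<in> carrier (CCube G m)\<close> by (auto simp: carrier_CCube)
    have "lin_ext (psi_cube m) c \<in> carrier (free_mod (allowed_paths G m \<union> degenerate_tuples (verts G) m))"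
      using c(1) by (rule lin_ext_closed) (rule psi_cube_closed)
    then show ?thesis
      using c free_mod_mono[OF weak_paths_subset, of G m]
      by (auto simp: psi_class tuple_class_allowed_iff)
  qed
  show ?thesis
    using allowed[OF assms] allowed[OF mod_homD(1)[OF dCube_hom assms]] psi_chain_map[OF assms]
    by (simp add: carrier_CPath)
qed

lemma psi_mod_hom: "psi G n \<in> mod_hom (CCube G n) (CPath G n)"
  by (intro mod_homI psi_closed) (simp_all add: CPath_def mod_homD(2,3)[OF psi_CTuple_hom])

section \<open>Low degrees\<close>

lemma cube_vertex_simps:
  "cube_vertex 0 A = []" "cube_vertex (Suc n) A = cube_vertex n A @ [Suc n \<in> A]"
  by (simp_all add: cube_vertex_def)

lemma psi_cube_0: "psi_cube 0 \<sigma> = Poly_Mapping.single [\<sigma> []] 1"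
  by (simp add: psi_cube_eq cube_path_def cube_vertex_simps)

lemma psi_cube_1: "psi_cube 1 \<sigma> = Poly_Mapping.single [\<sigma> [False], \<sigma> [True]] 1"
  by (simp add: psi_cube_eq cube_path_def cube_vertex_simps)

lemma psi_cube_2: "psi_cube 2 \<sigma> =
  Poly_Mapping.single [\<sigma> [False, False], \<sigma> [True, False], \<sigma> [True, True]] 1
  - Poly_Mapping.single [\<sigma> [False, False], \<sigma> [False, True], \<sigma> [True, True]] 1"
proof -
  have "{1..2::nat} = {1, 2}" by auto
  moreover have "id \<noteq> transpose 1 (2::nat)" by (metis id_apply transpose_apply_first one_eq_numeral_iff semiring_norm(85))
  ultimately have "psi_cube 2 \<sigma> = Poly_Mapping.single (cube_path 2 \<sigma> id) 1
      - Poly_Mapping.single (cube_path 2 \<sigma> (transpose 1 2)) 1"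
    by (simp add: psi_cube_eq permutes_doubleton_iff evenperm_swap Collect_disj_eq del: One_nat_def)
  also have "cube_path 2 \<sigma> id = [\<sigma> [False, False], \<sigma> [True, False], \<sigma> [True, True]]"
    by (simp add: cube_path_def cube_vertex_simps numeral_2_eq_2 atLeastAtMostSuc_conv)
  also have "cube_path 2 \<sigma> (transpose 1 2) = [\<sigma> [False, False], \<sigma> [False, True], \<sigma> [True, True]]"
    by (simp add: cube_path_def cube_vertex_simps numeral_2_eq_2 atLeastAtMostSuc_conv)
  finally show ?thesis .
qed

lemma length_bool_list:
  "length a = 1 \<longleftrightarrow> a = [False] \<or> a = [True]"
  "length a = 2 \<longleftrightarrow> a = [False, False] \<or> a = [False, True] \<or> a = [True, False] \<or> a = [True, True]"
  by (auto simp: length_Suc_conv numeral_2_eq_2)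

section \<open>Bijectivity on chains in degrees zero and one\<close>

lemma lin_ext_single_zero_imp:
  assumes "inj_on g S" "c \<in> carrier (free_mod S)"
    and "lin_ext (\<lambda>x. Poly_Mapping.single (g x) 1) c \<in> carrier (free_mod D)"
  shows "c \<in> carrier (free_mod {x \<in> S. g x \<in> D})"
proof -
  have "Poly_Mapping.lookup c x = 0" if x: "x \<in> S" "g x \<notin> D" for x
  proof -
    \<comment> \<open>By injectivity, \<open>x\<close> is the only generator in the support of
      \<open>c\<close> that can be sent to \<open>g x\<close>, so the coefficient of
      \<open>g x\<close> in the image is that of \<open>x\<close> in \<open>c\<close>.\<close>
    have "0 = (\<Sum>y\<in>Poly_Mapping.keys c. Poly_Mapping.lookup c y * (1 when g y = g x))"
      using assms(3) x(2) by (simp add: mem_free_mod lookup_lin_ext lookup_single)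
    also have "\<dots> = (\<Sum>y\<in>Poly_Mapping.keys c. if y = x then Poly_Mapping.lookup c x else 0)"
      using assms(1,2) x(1) by (intro sum.cong) (auto simp: free_mod_def when_def dest: inj_onD)
    also have "\<dots> = Poly_Mapping.lookup c x"
      by (simp add: in_keys_iff)
    finally show ?thesis by simp
  qed
  with assms(2) show ?thesis by (auto simp: mem_free_mod)
qed

text \<open>With a single permutation, \<psi> sends a cube to one tuple. What remains is
  combinatorial: vertices and singular edges correspond to tuples with weakly adjacent steps, and
  degenerate tuples come only from degenerate cubes.\<close>

lemma psi_cube_le_1:
  assumes "n \<le> 1"
  obtains g where "\<And>\<sigma>. psi_cube n \<sigma> = (Poly_Mapping.single (g \<sigma>) 1 :: 'a list \<Rightarrow>\<^sub>0 'r::{comm_ring,comm_monoid_mult})"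
    "inj_on g (sing_cubes G n)" "g ` sing_cubes G n = {t \<in> tuples (verts G) n. \<forall>i<n. weakly_adjacent G (t ! i) (t ! Suc i)}"
    "\<And>\<sigma>. \<sigma> \<in> sing_cubes G n \<Longrightarrow> g \<sigma> \<in> degenerate_tuples (verts G) n \<Longrightarrow> \<sigma> \<in> degenerate_cubes G n"
proof -
  consider "n = 0" | "n = 1" using assms by linarith
  then show thesis
  proof cases
    case 1
    have "t \<in> (\<lambda>\<sigma>. [\<sigma> []]) ` sing_cubes G 0" if t': "t \<in> tuples (verts G) 0" for t
    proof -
      obtain v where t: "t = [v]" "v \<in> verts G"
        using t' by (auto simp: tuples_def length_Suc_conv)
      then have "restrict (\<lambda>_. v) {[]} \<in> sing_cubes G 0" by (auto simp: mem_sing_cubes)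
      then show ?thesis using t by (intro image_eqI[of _ _ "restrict (\<lambda>_. v) {[]}"]) auto
    qed
    then show thesis using 1
      by (intro that[of "\<lambda>\<sigma>. [\<sigma> []]"])
        (auto simp: psi_cube_0 inj_on_def mem_sing_cubes tuples_def degenerate_tuples_def intro: extensionalityI)
  next
    case 2
    have "t \<in> (\<lambda>\<sigma>. [\<sigma> [False], \<sigma> [True]]) ` sing_cubes G 1"
      if t': "t \<in> tuples (verts G) 1" "weakly_adjacent G (t ! 0) (t ! 1)" for t
    proof -
      obtain u v where t: "t = [u, v]" "u \<in> verts G" "v \<in> verts G"
        using t'(1) by (auto simp: tuples_def length_Suc_conv)
      let ?\<sigma> = "restrict (\<lambda>a. if a = [True] then v else u) {a. length a = 1}"
      have "?\<sigma> \<in> sing_cubes G 1" using t t'(2) weakly_adjacent_sym[of G u v]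
        unfolding mem_sing_cubes length_bool_list by (auto simp: weakly_adjacent_def)
      then show ?thesis using t by (intro image_eqI[of _ _ ?\<sigma>]) auto
    qed
    moreover have "\<sigma> = \<sigma>'" if "\<sigma> \<in> sing_cubes G 1" "\<sigma>' \<in> sing_cubes G 1"
      "\<sigma> [False] = \<sigma>' [False]" "\<sigma> [True] = \<sigma>' [True]" for \<sigma> \<sigma>'
    proof (rule extensionalityI)
      show "\<sigma> \<in> extensional {a. length a = 1}" "\<sigma>' \<in> extensional {a. length a = 1}"
        using that(1,2) by (auto simp: mem_sing_cubes)
    qed (use that(3,4) length_bool_list(1) in auto)
    moreover have "weakly_adjacent G (\<sigma> [False]) (\<sigma> [True])" "\<sigma> [b] \<in> verts G"
      if "\<sigma> \<in> sing_cubes G 1" for \<sigma> b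
      using that[unfolded mem_sing_cubes]
      by (auto dest: spec[of _ "[False]"] spec[of _ "[b]"])
    moreover have "\<sigma> \<in> degenerate_cubes G 1" if "\<sigma> \<in> sing_cubes G 1" "\<sigma> [False] = \<sigma> [True]" for \<sigma>
      using that unfolding degenerate_cubes_iff length_bool_list by auto
    ultimately show thesis
      by (intro that[unfolded 2, of "\<lambda>\<sigma>. [\<sigma> [False], \<sigma> [True]]"] inj_onI set_eqI iffI psi_cube_1)
        (auto simp: tuples_def degenerate_tuples_def)
  qed
qed

lemma psi_inj_on:
  assumes "n \<le> 1"
  shows "inj_on (psi G n :: ('a, 'r::{comm_ring,comm_monoid_mult}) cube_chain \<Rightarrow> _) (carrier (CCube G n))"
proof (rule inj_onI)
  obtain g where g: "\<And>\<sigma>. psi_cube n \<sigma> = (Poly_Mapping.single (g \<sigma>) 1 :: 'a list \<Rightarrow>\<^sub>0 'r)"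
    "inj_on g (sing_cubes G n)"
    "\<And>\<sigma>. \<sigma> \<in> sing_cubes G n \<Longrightarrow> g \<sigma> \<in> degenerate_tuples (verts G) n \<Longrightarrow> \<sigma> \<in> degenerate_cubes G n"
    using assms by (rule psi_cube_le_1) blast
  have psi: "psi_cube n = (\<lambda>\<sigma>. Poly_Mapping.single (g \<sigma>) 1 :: 'a list \<Rightarrow>\<^sub>0 'r)"
    by (rule ext) (rule g(1))
  fix x y :: "('a, 'r) cube_chain"
  assume "x \<in> carrier (CCube G n)" "y \<in> carrier (CCube G n)" and eq: "psi G n x = psi G n y"
  then obtain c d where c: "c \<in> carrier (free_mod (sing_cubes G n))" "x = cube_class G n c"
    and d: "d \<in> carrier (free_mod (sing_cubes G n))" "y = cube_class G n d"
    by (auto simp: carrier_CCube)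
  have "lin_ext (psi_cube n) c - lin_ext (psi_cube n) d \<in> degenerate_tuple_chains (verts G) n"
    using eq c d by (simp add: psi_class tuple_class_eq_iff lin_ext_closed[OF _ psi_cube_tuples])
  then have "lin_ext (\<lambda>\<sigma>. Poly_Mapping.single (g \<sigma>) 1) (c - d) \<in> carrier (free_mod (degenerate_tuples (verts G) n))"
    by (simp add: lin_ext_diff degenerate_tuple_chains_def psi)
  then have "c - d \<in> carrier (free_mod {\<sigma> \<in> sing_cubes G n. g \<sigma> \<in> degenerate_tuples (verts G) n})"
    using c(1) d(1) by (intro lin_ext_single_zero_imp g(2) free_mod_closed)
  then have "c - d \<in> degenerate_cube_chains G n"
    using free_mod_mono[of "{\<sigma> \<in> sing_cubes G n. g \<sigma> \<in> degenerate_tuples (verts G) n}" "degenerate_cubes G n"] g(3)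
    by (auto simp: degenerate_cube_chains_def)
  then show "x = y" using c d by (simp add: cube_class_eq_iff)
qed

text \<open>\<open>s\<close> picks a cube for each path. The error \<psi> (s t) - t has to be
  degenerate only after summation against \<open>c\<close>, not path by path; degree 2 depends on
  this freedom.\<close>

lemma tuple_class_in_psi_image:
  fixes c :: "'a list \<Rightarrow>\<^sub>0 'r::{comm_ring,comm_monoid_mult}"
  assumes c: "c \<in> carrier (free_mod (allowed_paths G n))"
    and s: "\<And>t. t \<in> allowed_paths G n \<Longrightarrow> s t \<in> sing_cubes G n"
    and degenerate: "lin_ext (\<lambda>t. psi_cube n (s t) - Poly_Mapping.single t 1) c \<in> degenerate_tuple_chains (verts G) n"
  shows "tuple_class (verts G) n c \<in> psi G n ` carrier (CCube G n)"
proof -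
  let ?y = "lin_ext (\<lambda>t. Poly_Mapping.single (s t) 1) c :: 'a cube \<Rightarrow>\<^sub>0 'r"
  have y: "?y \<in> carrier (free_mod (sing_cubes G n))"
    using c by (rule lin_ext_closed) (intro free_mod_closed s)
  have "c \<in> carrier (free_mod (tuples (verts G) n))"
    using c free_mod_mono[of "allowed_paths G n" "tuples (verts G) n"] by (auto simp: allowed_paths_def)
  moreover have "lin_ext (psi_cube n) ?y - c \<in> degenerate_tuple_chains (verts G) n"
    using degenerate by (simp add: lin_ext_lin_ext lin_ext_diff_fun lin_ext_unit)
  ultimately have "psi G n (cube_class G n ?y) = tuple_class (verts G) n c"
    using y by (simp add: psi_class tuple_class_eq_iff lin_ext_closed[OF _ psi_cube_tuples])
  then show ?thesis using y by (force simp: carrier_CCube)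
qed

lemma psi_surj_le_1:
  assumes "n \<le> 1"
  shows "psi G n ` carrier (CCube G n) = (carrier (CPath G n) :: ('a, 'r::{comm_ring,comm_monoid_mult}) path_chain set)"
proof
  show "psi G n ` carrier (CCube G n) \<subseteq> (carrier (CPath G n) :: ('a, 'r) path_chain set)"
    by (intro image_subsetI psi_closed)
  obtain g where g: "\<And>\<sigma>. psi_cube n \<sigma> = (Poly_Mapping.single (g \<sigma>) 1 :: 'a list \<Rightarrow>\<^sub>0 'r)"
    "g ` sing_cubes G n = {t \<in> tuples (verts G) n. \<forall>i<n. weakly_adjacent G (t ! i) (t ! Suc i)}"
    using assms by (rule psi_cube_le_1) blast
  have allowed: "t \<in> g ` sing_cubes G n" if "t \<in> allowed_paths G n" for t
    using that by (auto simp: g(2) allowed_paths_def weakly_adjacent_def)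
  show "(carrier (CPath G n) :: ('a, 'r) path_chain set) \<subseteq> psi G n ` carrier (CCube G n)"
  proof
    fix x :: "('a, 'r) path_chain" assume "x \<in> carrier (CPath G n)"
    then obtain c where c: "c \<in> carrier (free_mod (allowed_paths G n))" "x = tuple_class (verts G) n c"
      by (auto simp: carrier_CPath allowed_chains_def)
    \<comment> \<open>In these degrees each allowed path is itself the image of a cube, so the error
      vanishes for every path.\<close>
    have "lin_ext (\<lambda>t. psi_cube n (inv_into (sing_cubes G n) g t) - Poly_Mapping.single t 1) c = lin_ext (\<lambda>_. 0) c"
      using c(1) allowed by (intro lin_ext_cong[of _ "allowed_paths G n"]) (auto simp: g(1) f_inv_into_f)
    then have "lin_ext (\<lambda>t. psi_cube n (inv_into (sing_cubes G n) g t) - Poly_Mapping.single t 1) c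
        \<in> degenerate_tuple_chains (verts G) n"
      by (simp add: lin_ext_def degenerate_tuple_chains_def free_mod_closed)
    then show "x \<in> psi G n ` carrier (CCube G n)"
      unfolding c(2) using c(1) inv_into_into[OF allowed] by (intro tuple_class_in_psi_image)
  qed
qed

section \<open>Surjectivity on chains in degree two\<close>

definition square_cube :: "'a \<Rightarrow> 'a \<Rightarrow> 'a \<Rightarrow> 'a \<Rightarrow> 'a cube" where
  "square_cube u v v' w = restrict
     (\<lambda>a. if a ! 0 then (if a ! 1 then w else v) else (if a ! 1 then v' else u)) {a. length a = 2}"

lemma square_cube_sing_cubes:
  assumes "{u, v, v', w} \<subseteq> verts G" "weakly_adjacent G u v" "weakly_adjacent G v w"
    "weakly_adjacent G u v'" "weakly_adjacent G v' w"
  shows "square_cube u v v' w \<in> sing_cubes G 2"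
proof -
  have sym: "weakly_adjacent G v u" "weakly_adjacent G w v" "weakly_adjacent G v' u" "weakly_adjacent G w v'"
    using assms by (auto simp: weakly_adjacent_sym)
  have refl: "weakly_adjacent G x x" for x by (simp add: weakly_adjacent_def)
  have "weakly_adjacent G (square_cube u v v' w a) (square_cube u v v' w (a[j := b]))"
    if a: "length a = 2" and "j < 2" for a j b
  proof -
    from \<open>j < 2\<close> consider "j = 0" | "j = 1" by linarith
    then show ?thesis
      using a[unfolded length_bool_list] sym assms(2-) refl
      by cases (cases b; elim disjE; simp add: square_cube_def)+
  qed
  moreover have "square_cube u v v' w a \<in> verts G" if "length a = 2" for a
    using that assms(1) by (auto simp: square_cube_def)
  ultimately show ?thesis
    by (simp add: mem_sing_cubes) (simp add: square_cube_def)
qed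

text \<open>\<open>u\<close> and \<open>w\<close> are the corners 00 and 11, while \<open>v\<close>
  and \<open>v'\<close> are 10 and 01. The identity permutation passes through \<open>v\<close>, the
  transposition through \<open>v'\<close>.\<close>

lemma psi_cube_square:
  "psi_cube 2 (square_cube u v v' w) = Poly_Mapping.single [u, v, w] 1 - Poly_Mapping.single [u, v', w] 1"
  by (simp add: psi_cube_2 square_cube_def)

text \<open>
  A vertex \<open>m\<close>, depending only on \<open>u\<close> and \<open>w\<close>, such that every allowed path \<open>(u, v, w)\<close> spans a
  singular square with \<open>(u, m, w)\<close>; if \<open>u\<close> and \<open>w\<close> are equal or adjacent, then \<open>(u, m, w)\<close> is
  degenerate.
\<close>

definition midpoint :: "'a ugraph \<Rightarrow> 'a \<Rightarrow> 'a \<Rightarrow> 'a" where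
  "midpoint G u w = (if weakly_adjacent G u w then w
     else SOME v. v \<in> verts G \<and> weakly_adjacent G u v \<and> weakly_adjacent G v w)"

lemma midpoint:
  assumes "v \<in> verts G" "w \<in> verts G" "weakly_adjacent G u v" "weakly_adjacent G v w"
  shows "midpoint G u w \<in> verts G" "weakly_adjacent G u (midpoint G u w)"
    "weakly_adjacent G (midpoint G u w) w"
proof -
  have "midpoint G u w \<in> verts G \<and> weakly_adjacent G u (midpoint G u w) \<and>
      weakly_adjacent G (midpoint G u w) w"
  proof (cases "weakly_adjacent G u w")
    case True
    then show ?thesis using assms(2) by (simp add: midpoint_def) (simp add: weakly_adjacent_def)
  next
    case False
    then show ?thesis
      using someI[of "\<lambda>v. v \<in> verts G \<and> weakly_adjacent G u v \<and> weakly_adjacent G v w" v] assms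
      by (simp add: midpoint_def)
  qed
  then show "midpoint G u w \<in> verts G" "weakly_adjacent G u (midpoint G u w)"
    "weakly_adjacent G (midpoint G u w) w" by blast+
qed

lemma allowed_path_2E:
  assumes "t \<in> allowed_paths G 2"
  obtains u v w where "t = [u, v, w]" "{u, v, w} \<subseteq> verts G" "{u, v} \<in> edges G" "{v, w} \<in> edges G"
proof -
  have len: "length t = Suc (Suc (Suc 0))" and V: "set t \<subseteq> verts G"
    and E: "\<And>i. i < 2 \<Longrightarrow> {t ! i, t ! Suc i} \<in> edges G"
    using assms by (auto simp: allowed_paths_def tuples_def numeral_2_eq_2)
  from len obtain u v w where "t = [u, v, w]" by (auto simp: length_Suc_conv)
  with V E[of 0] E[of 1] show ?thesis by (intro that[of u v w]) auto
qed

lemma tuple_boundary_2: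
  "tuple_boundary 2 [u, v, w] = Poly_Mapping.single [v, w] 1 - Poly_Mapping.single [u, w] 1 + Poly_Mapping.single [u, v] 1"
  by (simp add: tuple_boundary_def numeral_2_eq_2 single_uminus)

text \<open>
  Replacing the middle vertex of every path in \<open>c\<close> by the midpoint collects, at \<open>(u, m, w)\<close>, the
  sum of the coefficients of all \<open>(u, v, w)\<close>. If \<open>u\<close> and \<open>w\<close> are neither equal nor adjacent, this
  sum is minus the coefficient of \<open>(u, w)\<close> in the boundary of \<open>c\<close>.
\<close>

lemma midpoint_chain_degenerate:
  fixes c :: "'a list \<Rightarrow>\<^sub>0 'r::{comm_ring,comm_monoid_mult}"
  assumes c: "c \<in> carrier (free_mod (allowed_paths G 2))"
    and bd: "lin_ext (tuple_boundary 2) c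
      \<in> carrier (free_mod (allowed_paths G 1 \<union> degenerate_tuples (verts G) 1))"
  shows "lin_ext (\<lambda>t. Poly_Mapping.single [t ! 0, midpoint G (t ! 0) (t ! 2), t ! 2] 1) c
    \<in> degenerate_tuple_chains (verts G) 2"
  unfolding degenerate_tuple_chains_def mem_free_mod
proof (intro allI impI)
  let ?f = "\<lambda>t. [t ! 0, midpoint G (t ! 0) (t ! 2), t ! 2]"
  let ?K = "Poly_Mapping.keys c"
  fix s assume s: "s \<notin> degenerate_tuples (verts G) 2"
  have K: "t \<in> allowed_paths G 2" if "t \<in> ?K" for t
    using c that by (auto simp: free_mod_def)
  have lookup: "Poly_Mapping.lookup (lin_ext (\<lambda>t. Poly_Mapping.single (?f t) 1) c) s
      = (\<Sum>t\<in>?K. Poly_Mapping.lookup c t * (1 when ?f t = s))"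
    by (simp add: lookup_lin_ext lookup_single)
  show "Poly_Mapping.lookup (lin_ext (\<lambda>t. Poly_Mapping.single (?f t) 1) c) s = 0"
  proof (cases "\<exists>t\<in>?K. ?f t = s")
    case False
    then show ?thesis unfolding lookup by (intro sum.neutral) auto
  next
    case True
    then obtain t where t: "t \<in> ?K" "?f t = s" by blast
    obtain u v w where uvw: "t = [u, v, w]" "{u, v, w} \<subseteq> verts G" "{u, v} \<in> edges G" "{v, w} \<in> edges G"
      using K[OF t(1)] by (rule allowed_path_2E)
    have s_eq: "s = [u, midpoint G u w, w]" using t(2) uvw(1) by simp
    \<comment> \<open>Otherwise the midpoint would be \<open>w\<close>, making \<open>s\<close>
      degenerate against its choice.\<close>
    have not_adj: "\<not> weakly_adjacent G u w"
    proof
      assume "weakly_adjacent G u w"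
      then have "s = [u, w, w]" by (simp add: s_eq midpoint_def)
      then show False using s uvw(2) by (auto simp: degenerate_tuples_def tuples_def numeral_2_eq_2 All_less_Suc)
    qed
    then have "[u, w] \<notin> allowed_paths G 1 \<union> degenerate_tuples (verts G) 1"
      by (auto simp: allowed_paths_def degenerate_tuples_def weakly_adjacent_def)
    then have "0 = Poly_Mapping.lookup (lin_ext (tuple_boundary 2) c) [u, w]"
      using bd by (simp add: mem_free_mod)
    also have "\<dots> = (\<Sum>t\<in>?K. - (Poly_Mapping.lookup c t * (1 when ?f t = s)))"
      unfolding lookup_lin_ext
    proof (rule sum.cong[OF refl])
      fix t assume "t \<in> ?K"
      then obtain a b d where t: "t = [a, b, d]" "{a, b} \<in> edges G" "{b, d} \<in> edges G"
        using allowed_path_2E[OF K] by metis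
      \<comment> \<open>The two outer faces of an allowed path are edges, so they differ from (u,
        w). Only deletion of the middle vertex contributes, with sign -1.\<close>
      with not_adj have "[b, d] \<noteq> [u, w]" "[a, b] \<noteq> [u, w]"
        by (auto simp: weakly_adjacent_def)
      then have "Poly_Mapping.lookup (tuple_boundary 2 t) [u, w] = - (1 when [a, d] = [u, w] :: 'r)"
        by (simp add: t(1) tuple_boundary_2 lookup_add lookup_minus lookup_single)
      also have "[a, d] = [u, w] \<longleftrightarrow> ?f t = s"
        by (auto simp: t(1) s_eq)
      finally show "Poly_Mapping.lookup c t * Poly_Mapping.lookup (tuple_boundary 2 t) [u, w]
          = - (Poly_Mapping.lookup c t * (1 when ?f t = s))"
        by simp
    qed
    also have "\<dots> = - Poly_Mapping.lookup (lin_ext (\<lambda>t. Poly_Mapping.single (?f t) 1) c) s"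
      by (simp add: lookup sum_negf)
    finally show ?thesis by simp
  qed
qed

lemma psi_surj_2:
  "psi G 2 ` carrier (CCube G 2) = (carrier (CPath G 2) :: ('a, 'r::{comm_ring,comm_monoid_mult}) path_chain set)"
proof
  show "psi G 2 ` carrier (CCube G 2) \<subseteq> (carrier (CPath G 2) :: ('a, 'r) path_chain set)"
    by (intro image_subsetI psi_closed)
  show "(carrier (CPath G 2) :: ('a, 'r) path_chain set) \<subseteq> psi G 2 ` carrier (CCube G 2)"
  proof
    fix x :: "('a, 'r) path_chain" assume x: "x \<in> carrier (CPath G 2)"
    then obtain c where c: "c \<in> carrier (free_mod (allowed_paths G 2))" "x = tuple_class (verts G) 2 c"
      by (auto simp: carrier_CPath allowed_chains_def)
    then have c': "c \<in> carrier (free_mod (tuples (verts G) 2))"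
      using free_mod_mono[of "allowed_paths G 2" "tuples (verts G) 2"] by (auto simp: allowed_paths_def)
    have "dTuple (verts G) 2 x \<in> allowed_chains G 1"
      using x by (simp add: carrier_CPath)
    moreover have "dTuple (verts G) 2 x = tuple_class (verts G) 1 (lin_ext (tuple_boundary 2) c)"
      using dTuple_class[OF c'] by (simp add: c(2))
    moreover have "lin_ext (tuple_boundary 2) c \<in> carrier (free_mod (tuples (verts G) (2 - 1)))"
      using c' by (rule lin_ext_closed) (rule tuple_boundary_closed)
    ultimately have bd: "lin_ext (tuple_boundary 2) c
        \<in> carrier (free_mod (allowed_paths G 1 \<union> degenerate_tuples (verts G) 1))"
      by (simp add: tuple_class_allowed_iff)
    let ?s = "\<lambda>t. square_cube (t ! 0) (t ! 1) (midpoint G (t ! 0) (t ! 2)) (t ! 2)"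
    let ?f = "\<lambda>t. [t ! 0, midpoint G (t ! 0) (t ! 2), t ! 2]"
    have "?s t \<in> sing_cubes G 2" if allowed: "t \<in> allowed_paths G 2" for t
    proof -
      obtain u v w where t: "t = [u, v, w]" "{u, v, w} \<subseteq> verts G" "{u, v} \<in> edges G" "{v, w} \<in> edges G"
        using allowed by (rule allowed_path_2E)
      then have "weakly_adjacent G u v" "weakly_adjacent G v w" by (auto simp: weakly_adjacent_def)
      with t show ?thesis
        using midpoint[of v G w u] by (auto intro!: square_cube_sing_cubes)
    qed
    moreover have "lin_ext (\<lambda>t. psi_cube 2 (?s t) - Poly_Mapping.single t 1) c
        \<in> degenerate_tuple_chains (verts G) 2"
    proof -
      \<comment> \<open>The error of each path is minus its midpoint path, so the total error is
        minus the midpoint chain, which the boundary condition makes degenerate.\<close>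
      have "psi_cube 2 (?s t) - Poly_Mapping.single t 1 = 0 - Poly_Mapping.single (?f t) (1 :: 'r)"
        if "t \<in> allowed_paths G 2" for t
        using that by (rule allowed_path_2E) (simp add: psi_cube_square)
      then have "lin_ext (\<lambda>t. psi_cube 2 (?s t) - Poly_Mapping.single t 1) c
          = lin_ext (\<lambda>t. 0 - Poly_Mapping.single (?f t) 1) c"
        by (intro lin_ext_cong[OF c(1)])
      also have "\<dots> = - lin_ext (\<lambda>t. Poly_Mapping.single (?f t) 1) c"
        unfolding lin_ext_diff_fun by (simp add: lin_ext_def)
      finally show ?thesis
        using midpoint_chain_degenerate[OF c(1) bd]
        by (simp add: degenerate_tuple_chains_def free_mod_closed)
    qed
    ultimately show "x \<in> psi G 2 ` carrier (CCube G 2)"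
      unfolding c(2) by (rule tuple_class_in_psi_image[OF c(1)])
  qed
qed

section \<open>The induced map on homology\<close>

lemma cycles_CCube: "cycles (CCube G) (dCube G) n
    = {x \<in> carrier (CCube G n). dCube G n x \<in> {\<zero>\<^bsub>CCube G (n - 1)\<^esub>}}"
  by (simp add: cycles_def a_kernel_def')

lemma cycles_CPath: "cycles (CPath G) (dPath G) n
    = {x \<in> carrier (CPath G n). dTuple (verts G) n x = \<zero>\<^bsub>CTuple (verts G) (n - 1)\<^esub>}"
  by (simp add: cycles_def a_kernel_def' dPath_def CPath_def)

lemma cycles_CCube_subgroup: "scaled_subgroup (cycles (CCube G) (dCube G) n) (CCube G n)"
  unfolding cycles_CCube
  by (intro scaled_subgroup_vimage[OF dCube_hom] scaled_subgroup_carrier scaled_subgroup_zero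
      scaled_group_CCube)

lemma boundaries_CCube_subgroup: "scaled_subgroup (boundaries (CCube G) (dCube G) n) (CCube G n)"
  unfolding boundaries_def
  by (intro scaled_subgroup_image[OF dCube_hom[of G "Suc n", unfolded diff_Suc_1]]
      scaled_subgroup_carrier scaled_group_CCube)

lemma boundaries_CPath_subgroup: "scaled_subgroup (boundaries (CPath G) (dPath G) n) (CTuple (verts G) n)"
  unfolding boundaries_def dPath_def
  by (intro scaled_subgroup_image[OF dTuple_hom[of "verts G" "Suc n", unfolded diff_Suc_1]]
      CPath_subgroup scaled_group_CTuple)

lemma psi_zero: "psi G n \<zero>\<^bsub>CCube G n\<^esub> = \<zero>\<^bsub>CTuple (verts G) n\<^esub>"
  by (intro mod_hom_zero_minus[OF psi_CTuple_hom] scaled_group.axioms(1)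
      scaled_group_CCube scaled_group_CTuple)

lemma psi_cycles: "psi G n ` cycles (CCube G) (dCube G) n \<subseteq> cycles (CPath G) (dPath G) n"
  by (auto simp: cycles_CCube cycles_CPath psi_closed psi_chain_map[symmetric] psi_zero simp del: One_nat_def)

lemma psi_boundaries: "psi G n ` boundaries (CCube G) (dCube G) n \<subseteq> boundaries (CPath G) (dPath G) n"
proof (intro image_subsetI)
  fix x assume "x \<in> boundaries (CCube G) (dCube G) n"
  then obtain y where y: "y \<in> carrier (CCube G (Suc n))" "x = dCube G (Suc n) y"
    by (auto simp: boundaries_def)
  then have "psi G n x = dTuple (verts G) (Suc n) (psi G (Suc n) y)"
    using psi_chain_map[OF y(1)] by simp
  then show "psi G n x \<in> boundaries (CPath G) (dPath G) n"
    using psi_closed[OF y(1)] by (simp add: boundaries_def dPath_def)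
qed

lemma psi_surj:
  assumes "n \<le> 2"
  shows "psi G n ` carrier (CCube G n) = carrier (CPath G n)"
  using psi_surj_le_1[of n G] psi_surj_2[of G] assms by (cases "n = 2") simp_all

text \<open>A cycle lifts to a chain by surjectivity in degree n. The boundary of the lift is sent
  to zero, and injectivity in degree n - 1, which is at most 1, makes it zero.\<close>

lemma psi_cycles_surj:
  assumes "n \<le> 2"
  shows "psi G n ` cycles (CCube G) (dCube G) n = cycles (CPath G) (dPath G) n"
proof (intro subset_antisym psi_cycles subsetI)
  fix z assume "z \<in> cycles (CPath G) (dPath G) n"
  then have z: "z \<in> carrier (CPath G n)" "dTuple (verts G) n z = \<zero>\<^bsub>CTuple (verts G) (n - 1)\<^esub>"
    by (auto simp: cycles_CPath)
  obtain x where x: "x \<in> carrier (CCube G n)" "z = psi G n x"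
    using z(1) psi_surj[OF assms, of G] by blast
  have "psi G (n - 1) (dCube G n x) = psi G (n - 1) \<zero>\<^bsub>CCube G (n - 1)\<^esub>"
    using z(2) by (simp only: psi_chain_map[OF x(1)] psi_zero x(2))
  then have "dCube G n x = \<zero>\<^bsub>CCube G (n - 1)\<^esub>"
  proof (rule inj_onD[OF psi_inj_on, rotated])
    show "n - 1 \<le> 1" using assms by simp
    show "dCube G n x \<in> carrier (CCube G (n - 1))" using mod_homD(1)[OF dCube_hom x(1)] .
    show "\<zero>\<^bsub>CCube G (n - 1)\<^esub> \<in> carrier (CCube G (n - 1))"
      by (intro abelian_monoid.zero_closed abelian_group.axioms(1) scaled_group.axioms(1) scaled_group_CCube)
  qed
  with x show "z \<in> psi G n ` cycles (CCube G) (dCube G) n" by (simp add: cycles_CCube)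
qed

text \<open>The chain bounded by the image lifts by surjectivity in degree n + 1, which is at most
  2. Injectivity in degree n identifies the boundary of the lift with \<open>z\<close>.\<close>

lemma psi_reflects_boundaries:
  assumes "n \<le> 1" "z \<in> carrier (CCube G n)" "psi G n z \<in> boundaries (CPath G) (dPath G) n"
  shows "z \<in> boundaries (CCube G) (dCube G) n"
proof -
  obtain w where w: "w \<in> carrier (CPath G (Suc n))" "psi G n z = dTuple (verts G) (Suc n) w"
    using assms(3) by (auto simp: boundaries_def dPath_def)
  obtain y where y: "y \<in> carrier (CCube G (Suc n))" "w = psi G (Suc n) y"
    using w(1) psi_surj[of "Suc n" G] assms(1) by auto
  have "psi G n z = psi G n (dCube G (Suc n) y)"
    using w(2) psi_chain_map[OF y(1)] y(2) by simp
  moreover have "dCube G (Suc n) y \<in> carrier (CCube G n)"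
    using mod_homD(1)[OF dCube_hom y(1)] by simp
  ultimately have "z = dCube G (Suc n) y"
    using inj_onD[OF psi_inj_on[OF assms(1)]] assms(2) by blast
  with y(1) show ?thesis by (simp add: boundaries_def)
qed

text \<open>\<open>CPath\<close> and \<open>CTuple\<close> differ only in the carrier, so the path
  side of homology can be handled as a subquotient of \<open>CTuple\<close>.\<close>

lemma psi_star_eq: "psi_star G n = quot_map (CTuple (verts G) n) (boundaries (CPath G) (dPath G) n) (psi G n)"
  by (simp add: psi_star_def CPath_def)

lemma HCube_eq: "HCube G n
    = quot_mod ((CCube G n)\<lparr>carrier := cycles (CCube G) (dCube G) n\<rparr>) (boundaries (CCube G) (dCube G) n)"
  by (simp add: HCube_def homology_def)

lemma HPath_eq: "HPath G n = quot_mod ((CTuple (verts G) n)\<lparr>carrier := cycles (CPath G) (dPath G) n\<rparr>)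
    (boundaries (CPath G) (dPath G) n)"
  by (simp add: HPath_def homology_def CPath_def)

lemma cycles_CPath_subset: "cycles (CPath G) (dPath G) n \<subseteq> carrier (CTuple (verts G) n)"
proof -
  have "carrier (CPath G n) \<subseteq> carrier (CTuple (verts G) n)"
    by (rule additive_subgroup.a_subset[OF scaled_subgroup.axioms(2)[OF CPath_subgroup]])
  then show ?thesis by (auto simp: cycles_CPath)
qed

lemmas psi_subquotient = quot_map_subquotient[OF boundaries_CCube_subgroup boundaries_CPath_subgroup
    additive_subgroup.a_subset[OF scaled_subgroup.axioms(2)[OF cycles_CCube_subgroup]] cycles_CPath_subset
    psi_CTuple_hom psi_cycles psi_boundaries, folded psi_star_eq HCube_eq HPath_eq]

theorem theorem5p4:
  fixes G :: "'a ugraph"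
  assumes "finite_simple_graph G"
  shows
    "(\<forall>n. (psi G n :: ('a, 'r::{comm_ring,comm_monoid_mult}) cube_chain \<Rightarrow> ('a, 'r) path_chain)
            \<in> mod_hom (CCube G n) (CPath G n)
        \<and> (psi G n :: ('a, 'r) cube_chain \<Rightarrow> ('a, 'r) path_chain)
            ` cycles (CCube G) (dCube G) n \<subseteq> cycles (CPath G) (dPath G) n
        \<and> (psi G n :: ('a, 'r) cube_chain \<Rightarrow> ('a, 'r) path_chain)
            ` boundaries (CCube G) (dCube G) n \<subseteq> boundaries (CPath G) (dPath G) n
        \<and> (psi_star G n :: ('a, 'r) cube_chain set \<Rightarrow> ('a, 'r) path_chain set)
            \<in> mod_hom (HCube G n) (HPath G n)
        \<and> (\<forall>z \<in> cycles (CCube G) (dCube G) n.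
             psi_star G n (homology_class (CCube G) (dCube G) n z)
               = homology_class (CPath G) (dPath G) n (psi G n z :: ('a, 'r) path_chain)))
     \<and> (\<forall>n\<le>1. (psi_star G n :: ('a, 'r) cube_chain set \<Rightarrow> ('a, 'r) path_chain set)
            \<in> mod_iso (HCube G n) (HPath G n))
     \<and> (psi_star G 2 :: ('a, 'r) cube_chain set \<Rightarrow> ('a, 'r) path_chain set)
            ` carrier (HCube G 2) = carrier (HPath G 2)"
proof (intro conjI allI impI ballI)
  fix n and z :: "('a, 'r) cube_chain" assume "z \<in> cycles (CCube G) (dCube G) n"
  then show "psi_star G n (homology_class (CCube G) (dCube G) n z)
      = homology_class (CPath G) (dPath G) n (psi G n z)"
    using psi_subquotient(2) by (simp add: homology_class_def CPath_def)
next
  fix n :: nat assume n: "n \<le> 1"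
  show "(psi_star G n :: ('a, 'r) cube_chain set \<Rightarrow> _) \<in> mod_iso (HCube G n) (HPath G n)"
  proof (rule psi_subquotient(4))
    show "psi G n ` cycles (CCube G) (dCube G) n = (cycles (CPath G) (dPath G) n :: ('a, 'r) path_chain set)"
      using n by (intro psi_cycles_surj) simp
    fix z :: "('a, 'r) cube_chain"
    assume "z \<in> cycles (CCube G) (dCube G) n" "psi G n z \<in> boundaries (CPath G) (dPath G) n"
    then show "z \<in> boundaries (CCube G) (dCube G) n"
      using n by (intro psi_reflects_boundaries) (auto simp: cycles_CCube)
  qed (rule cycles_CCube_subgroup)
qed (rule psi_mod_hom psi_cycles psi_boundaries psi_subquotient(1)
    psi_subquotient(3)[OF psi_cycles_surj[OF order_refl]])+

end
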